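(* Let $r\ge2$ and $s>r$. Let $H$ be an $(s,s-r)$-starplus on $k$ vertices (with $k>s$) with $\lambda_1\ge2$ rays and excess $\lambda_2\ge 0$ such that $$\frac{\lambda_1+\lambda_2}{\lambda_1-1}\le\frac{k-s+r}{k-s}$$ and whose flower $H_1$ is edge-balanced. Then there is a strategy $\mathcal S$ such that for every $t=t(n)\gg n^{\,r-\frac{k-s+r}{\lambda_1+\lambda_2}}$, a.a.s. $G^{(r,s)}_t$ contains a copy of $H$. Consequently (together with the general lower bound) $\tau^{(r)}(H)=n^{\,r-\frac{k-s+r}{\lambda_1+\lambda_2}}$.
   Context: Semi-random hypergraph process: fix integers $1\le r<s$ and $n\ge s$. Start with the empty $s$-uniform multi-hypergraph $G_0^{(r,s)}$ on $[n]$. In each step $t\ge1$, a set $U_t$ of $r$ vertices is chosen uniformly at random among all $r$-subsets of $[n]$, independently of all previous choices; the player chooses an $(s-r)$-set $V_t\subseteq[n]\setminus U_t$, and the edge $U_t\cup V_t$ is added to form $G^{(r,s)}_t$ (parallel edges allowed). A strategy is, for each $n$, a sequence of functions determining $V_t$ from $(U_1,V_1,\dots,U_{t-1},V_{t-1},U_t)$. A.a.s. means with probability $\to1$ as $n\to\infty$; $a_n\gg b_n$ means $b_n=o(a_n)$. "$\tau^{(r)}(H)\le f$": some strategy gives, for every $t\gg f$, a.a.s. a copy of $H$ in $G_t^{(r,s)}$; "$\tau^{(r)}(H)\ge f$": for every strategy and $t=o(f)$, a.a.s. no copy; "$=$" means both. Starplus: for integers $1\le c<s$, an $(s,c)$-starplus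 with $\lambda_1$ rays and excess $\lambda_2$ is an $s$-uniform hypergraph $H$ on a vertex set $V$ with a distinguished set $C\subseteq V$, $|C|=c$ (the center), such that exactly $\lambda_1$ edges contain $C$, these $\lambda_1$ edges together cover all of $V$, and the remaining $\lambda_2$ edges (the cap) do not contain $C$ (they may intersect $C$). The flower of $H$ is the $(s-c)$-uniform hypergraph $H_1$ on vertex set $V\setminus C$ with edge set $\{e\setminus C: C\subseteq e\in E(H)\}$. Density and edge-balancedness: for an $r$-uniform hypergraph $F$ with $v_F$ vertices and $e_F\ge1$ edges, $g(F)=1/r$ if $e_F=1$ and $g(F)=\frac{e_F-1}{v_F-r}$ if $e_F>1$. $F$ is edge-balanced if every sub-hypergraph $F'\subseteq F$ with $e_{F'}>0$ satisfies $g(F')\le g(F)$. *)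

theory Defs
  imports Complex_Main "HOL-Library.Landau_Symbols"
begin

definition starplus :: "nat \<Rightarrow> nat \<Rightarrow> 'a set \<Rightarrow> 'a set set \<Rightarrow> 'a set \<Rightarrow> nat \<Rightarrow> nat \<Rightarrow> bool" where
  "starplus s c V E C l1 l2 \<longleftrightarrow>
     1 \<le> c \<and> c < s \<and> finite V \<and> (\<forall>e\<in>E. e \<subseteq> V \<and> card e = s) \<and>
     C \<subseteq> V \<and> card C = c \<and>
     card {e\<in>E. C \<subseteq> e} = l1 \<and> \<Union>{e\<in>E. C \<subseteq> e} = V \<and>
     card {e\<in>E. \<not> C \<subseteq> e} = l2"

text \<open>Edge set of the flower (its vertex set is V - C).\<close>
definition flower :: "'a set \<Rightarrow> 'a set set \<Rightarrow> 'a set set" where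
  "flower C E = {e - C | e. e \<in> E \<and> C \<subseteq> e}"

definition gdens :: "nat \<Rightarrow> nat \<Rightarrow> nat \<Rightarrow> real" where
  "gdens r v m = (if m = 1 then 1 / real r else (real m - 1) / (real v - real r))"

definition edge_balanced :: "nat \<Rightarrow> 'a set \<Rightarrow> 'a set set \<Rightarrow> bool" where
  "edge_balanced r V E \<longleftrightarrow>
     (\<forall>V' E'. V' \<subseteq> V \<and> E' \<subseteq> E \<and> (\<forall>e\<in>E'. e \<subseteq> V') \<and> E' \<noteq> {} \<longrightarrow>
        gdens r (card V') (card E') \<le> gdens r (card V) (card E))"

definition rsets :: "nat \<Rightarrow> nat \<Rightarrow> nat set set" where
  "rsets n r = {U. U \<subseteq> {..<n} \<and> card U = r}"

text \<open>A strategy: for each n, a function from the history (U_1,V_1),...,(U_{t-1},V_{t-1})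
  and the new random set U_t to the player's choice V_t.\<close>
type_synonym strategy = "nat \<Rightarrow> (nat set \<times> nat set) list \<Rightarrow> nat set \<Rightarrow> nat set"

definition valid_strategy :: "nat \<Rightarrow> nat \<Rightarrow> strategy \<Rightarrow> bool" where
  "valid_strategy r s \<sigma> \<longleftrightarrow>
     (\<forall>n\<ge>s. \<forall>h U. U \<in> rsets n r \<longrightarrow>
        \<sigma> n h U \<subseteq> {..<n} - U \<and> card (\<sigma> n h U) = s - r)"

definition play :: "strategy \<Rightarrow> nat \<Rightarrow> nat set list \<Rightarrow> (nat set \<times> nat set) list" where
  "play \<sigma> n Us = foldl (\<lambda>h U. h @ [(U, \<sigma> n h U)]) [] Us"

definition graph_edges :: "strategy \<Rightarrow> nat \<Rightarrow> nat set list \<Rightarrow> nat set list" where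
  "graph_edges \<sigma> n Us = map (\<lambda>(U, W). U \<union> W) (play \<sigma> n Us)"

definition has_copy :: "nat \<Rightarrow> 'a set \<Rightarrow> 'a set set \<Rightarrow> nat set list \<Rightarrow> bool" where
  "has_copy n V E Es \<longleftrightarrow>
     (\<exists>\<phi>. inj_on \<phi> V \<and> \<phi> ` V \<subseteq> {..<n} \<and> (\<forall>e\<in>E. \<phi> ` e \<in> set Es))"

text \<open>Probability that G_t (under strategy sigma, on [n]) contains a copy of H = (V,E);
  U_1..U_t are independent uniform r-subsets of [n].\<close>
definition prob_copy :: "nat \<Rightarrow> strategy \<Rightarrow> nat \<Rightarrow> nat \<Rightarrow> 'a set \<Rightarrow> 'a set set \<Rightarrow> real" where
  "prob_copy r \<sigma> n t V E =
     real (card {Us. length Us = t \<and> set Us \<subseteq> rsets n r \<and> has_copy n V E (graph_edges \<sigma> n Us)})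
     / real (card (rsets n r)) ^ t"

definition tau_upper :: "nat \<Rightarrow> nat \<Rightarrow> 'a set \<Rightarrow> 'a set set \<Rightarrow> (nat \<Rightarrow> real) \<Rightarrow> bool" where
  "tau_upper r s V E f \<longleftrightarrow>
     (\<exists>\<sigma>. valid_strategy r s \<sigma> \<and>
        (\<forall>t :: nat \<Rightarrow> nat. f \<in> o(\<lambda>n. real (t n)) \<longrightarrow>
           ((\<lambda>n. prob_copy r \<sigma> n (t n) V E) \<longlongrightarrow> 1) sequentially))"

definition tau_lower :: "nat \<Rightarrow> nat \<Rightarrow> 'a set \<Rightarrow> 'a set set \<Rightarrow> (nat \<Rightarrow> real) \<Rightarrow> bool" where
  "tau_lower r s V E f \<longleftrightarrow>
     (\<forall>\<sigma>. valid_strategy r s \<sigma> \<longrightarrow>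
        (\<forall>t :: nat \<Rightarrow> nat. (\<lambda>n. real (t n)) \<in> o(f) \<longrightarrow>
           ((\<lambda>n. prob_copy r \<sigma> n (t n) V E) \<longlongrightarrow> 0) sequentially))"

end

theory Submission
  imports Defs "HOL-Library.FuncSet" "HOL-Library.Discrete_Functions"
begin

text \<open>Upper bound: the player plays in rounds of doubling length. In the first part of a round all
  rays are built over one fixed center, so the random \<open>r\<close>-sets form a random hypergraph in which
  copies of the flower are counted by a second moment argument. The density condition says that, on
  average, an \<open>r\<close>-set lies in boundedly many other copies once it is a flower edge. Hence a positive
  fraction of the copies survives as a conflict-free family, in which every \<open>r\<close>-set is responsible for
  at most one copy per cap edge. In the second part the player answers a responsible \<open>r\<close>-set by
  completing the cap edge of its copy, and another second moment argument shows that some copy of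
  the family is completed. Each edge of \<open>H\<close> has its own time block, so that hits for different edges
  are independent.

  Lower bound: fix the times at which the edges of a copy appear. The earliest edge determines the
  images of \<open>s\<close> vertices, and each later edge must contain the random set of its step.\<close>

subsection \<open>Averages over random lists\<close>

text \<open>Write \<open>N = n div k\<close>, \<open>m = card (V - C)\<close>, \<open>q\<close> for
  the chance that a given \<open>r\<close>-set occurs in one block,
  \<open>\<theta> = m / (l1 + l2)\<close> and \<open>y = q * N powr \<theta>\<close>. The exponent
  \<open>\<theta>\<close> is the one for which the expected number \<open>N^m * q^(l1 + l2)\<close>
  of completely hit copies equals \<open>y^(l1 + l2)\<close>. The assumption on \<open>t\<close>
  makes \<open>y\<close> tend to infinity, and every error is at most a constant over
  \<open>sqrt y\<close>.

  The obstacle is that one occurrence of an \<open>r\<close>-set yields one edge, while several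
  copies may want it. Above the threshold the bound on conflicts per copy is not constant but of
  order \<open>y^(l1 - 1)\<close>; this is affordable because \<open>y^(l1 + l2)\<close> outweighs
  it. The rounds double because the strategy is fixed before \<open>t\<close> is known: some
  complete round then has length proportional to \<open>t\<close>.\<close>

primrec avg :: "'b set \<Rightarrow> nat \<Rightarrow> ('b list \<Rightarrow> real) \<Rightarrow> real" where
  "avg R 0 f = f []"
| "avg R (Suc T) f = (\<Sum>u\<in>R. avg R T (\<lambda>us. f (u # us))) / real (card R)"

lemma avg_mono:
  assumes "\<And>us. set us \<subseteq> R \<Longrightarrow> length us = T \<Longrightarrow> f us \<le> g us"
  shows "avg R T f \<le> avg R T g"
  using assms
proof (induction T arbitrary: f g)
  case (Suc T)
  show ?case
    by (auto intro!: divide_right_mono sum_mono Suc.IH Suc.prems)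
qed auto

lemma avg_cong:
  assumes "\<And>us. set us \<subseteq> R \<Longrightarrow> length us = T \<Longrightarrow> f us = g us"
  shows "avg R T f = avg R T g"
  by (intro antisym avg_mono) (simp_all add: assms)

text \<open>Conditioning on a prefix: the recursion of \<open>avg\<close> makes the expectation an
  iterated one, so a suffix can be averaged while the prefix, and with it every answer of the player
  so far, is held fixed.\<close>

lemma avg_add: "avg R (a + b) f = avg R a (\<lambda>xs. avg R b (\<lambda>ys. f (xs @ ys)))"
  by (induction a arbitrary: f) auto

lemma avg_plus: "avg R T (\<lambda>us. f us + g us) = avg R T f + avg R T g"
  by (induction T arbitrary: f g) (auto simp: sum.distrib add_divide_distrib)

lemma avg_cmult: "avg R T (\<lambda>us. c * f us) = c * avg R T f"
  by (induction T arbitrary: f) (auto simp: sum_distrib_left)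

lemma avg_multc: "avg R T (\<lambda>us. f us * c) = avg R T f * c"
  using avg_cmult[of R T c f] by (simp add: mult.commute)

lemma avg_zero: "avg R T (\<lambda>us. 0) = 0"
  by (induction T) auto

lemma avg_sum: "avg R T (\<lambda>us. \<Sum>x\<in>X. f x us) = (\<Sum>x\<in>X. avg R T (f x))"
  by (induction X rule: infinite_finite_induct) (auto simp: avg_plus avg_zero)

lemma avg_const: "finite R \<Longrightarrow> R \<noteq> {} \<Longrightarrow> avg R T (\<lambda>us. c) = c"
  by (induction T) auto

lemma avg_card: "finite R \<Longrightarrow>
  avg R T (\<lambda>us. of_bool (P us)) = real (card {us. length us = T \<and> set us \<subseteq> R \<and> P us}) / real (card R) ^ T"
proof (induction T arbitrary: P)
  case 0
  show ?case by (cases "P []") (auto simp: card_1_singleton_iff cong: conj_cong)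
next
  case (Suc T)
  let ?A = "\<lambda>u. {us. length us = T \<and> set us \<subseteq> R \<and> P (u # us)}"
  have "{us. length us = Suc T \<and> set us \<subseteq> R \<and> P us} = (\<Union>u\<in>R. (#) u ` ?A u)"
    by (auto simp: length_Suc_conv image_iff)
  moreover have "finite (?A u)" for u
    by (rule finite_subset[OF _ finite_lists_length_eq[OF Suc.prems, of T]]) auto
  ultimately have "card {us. length us = Suc T \<and> set us \<subseteq> R \<and> P us} = (\<Sum>u\<in>R. card ((#) u ` ?A u))"
    using Suc.prems by (simp, subst card_UN_disjoint; auto)
  also have "\<dots> = (\<Sum>u\<in>R. card (?A u))"
    by (intro sum.cong refl card_image) auto
  finally show ?case using Suc.prems by (simp add: Suc.IH sum_divide_distrib mult.commute)
qed

lemma avg_prod_nth: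
  "avg R T (\<lambda>us. \<Prod>i<T. g i (us ! i)) = (\<Prod>i<T. (\<Sum>u\<in>R. g i u) / real (card R))"
proof (induction T arbitrary: g)
  case (Suc T)
  have "avg R (Suc T) (\<lambda>us. \<Prod>i<Suc T. g i (us ! i))
     = (\<Sum>u\<in>R. g 0 u * avg R T (\<lambda>us. \<Prod>i<T. g (Suc i) (us ! i))) / real (card R)"
    by (simp add: prod.lessThan_Suc_shift avg_cmult del: prod.lessThan_Suc)
  then show ?case
    by (simp add: Suc.IH[of "\<lambda>i. g (Suc i)"] prod.lessThan_Suc_shift sum_distrib_right del: prod.lessThan_Suc)
qed auto

lemma of_bool_Ball_prod: "finite A \<Longrightarrow> (\<Prod>i\<in>A. of_bool (P i)) = (of_bool (\<forall>i\<in>A. P i) :: real)"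
  by (induction A rule: finite_induct) auto

lemma avg_nth_in:
  assumes "finite R" "R \<noteq> {}" "J \<subseteq> {..<T}"
  shows "avg R T (\<lambda>us. of_bool (\<forall>i\<in>J. us ! i \<in> A i)) = (\<Prod>i\<in>J. real (card (A i \<inter> R)) / real (card R))"
proof -
  have fJ: "finite J" using assms(3) finite_subset by blast
  have "avg R T (\<lambda>us. of_bool (\<forall>i\<in>J. us ! i \<in> A i))
     = avg R T (\<lambda>us. \<Prod>i<T. if i \<in> J then of_bool (us ! i \<in> A i) else 1)"
    using assms(3) fJ
    by (intro avg_cong) (simp add: of_bool_Ball_prod[symmetric] prod.If_cases Int_absorb1)
  also have "\<dots> = (\<Prod>i<T. (\<Sum>u\<in>R. if i \<in> J then of_bool (u \<in> A i) else 1) / real (card R))"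
    by (rule avg_prod_nth)
  also have "\<dots> = (\<Prod>i<T. if i \<in> J then real (card (A i \<inter> R)) / real (card R) else 1)"
    using assms(1,2) by (intro prod.cong refl) (auto simp: of_bool_def sum.If_cases Int_commute)
  also have "\<dots> = (\<Prod>i\<in>J. real (card (A i \<inter> R)) / real (card R))"
    using assms(3) by (simp add: prod.If_cases Int_absorb1)
  finally show ?thesis .
qed

lemma finite_rsets: "finite (rsets n r)"
  unfolding rsets_def by (rule finite_subset[of _ "Pow {..<n}"]) auto

lemma card_rsets: "card (rsets n r) = n choose r"
  unfolding rsets_def using n_subsets[of "{..<n}" r] by simp

lemma rsets_nonempty: "r \<le> n \<Longrightarrow> rsets n r \<noteq> {}"
  using card_rsets[of n r] by (metis binomial_eq_0_iff card.empty not_le)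

lemma prob_copy_avg:
  "prob_copy r \<sigma> n t V E = avg (rsets n r) t (\<lambda>Us. of_bool (has_copy n V E (graph_edges \<sigma> n Us)))"
  by (simp add: prob_copy_def avg_card finite_rsets)

lemma play_snoc: "play \<sigma> n (Us @ [U]) = play \<sigma> n Us @ [(U, \<sigma> n (play \<sigma> n Us) U)]"
  by (simp add: play_def)

lemma length_play [simp]: "length (play \<sigma> n Us) = length Us"
  by (induction Us rule: rev_induct) (simp_all add: play_snoc, simp add: play_def)

lemma map_fst_play [simp]: "map fst (play \<sigma> n Us) = Us"
  by (induction Us rule: rev_induct) (simp_all add: play_snoc, simp add: play_def)

lemma length_graph_edges [simp]: "length (graph_edges \<sigma> n Us) = length Us"
  by (simp add: graph_edges_def)

lemma nth_graph_edges:
  "i < length Us \<Longrightarrow> graph_edges \<sigma> n Us ! i = Us ! i \<union> \<sigma> n (play \<sigma> n (take i Us)) (Us ! i)"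
proof (induction Us rule: rev_induct)
  case (snoc U Us)
  show ?case
  proof (cases "i < length Us")
    case True
    then show ?thesis using snoc by (simp add: graph_edges_def play_snoc nth_append)
  next
    case False
    then have "i = length Us" using snoc.prems by simp
    then show ?thesis by (simp add: graph_edges_def play_snoc nth_append)
  qed
qed simp

subsection \<open>The general lower bound\<close>

lemma of_bool_mono: "(P \<Longrightarrow> Q) \<Longrightarrow> of_bool P \<le> (of_bool Q :: real)"
  by (auto simp: of_bool_def)

lemma of_bool_le_sum:
  assumes "finite X" "P \<Longrightarrow> \<exists>x\<in>X. Q x"
  shows "of_bool P \<le> (\<Sum>x\<in>X. of_bool (Q x) :: real)"
proof (cases P)
  case True
  then obtain x where "x \<in> X" "Q x" using assms(2) by blast
  then show ?thesis
    using True assms(1) member_le_sum[of x X "\<lambda>x. of_bool (Q x) :: real"] by simp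
qed (auto intro!: sum_nonneg)

text \<open>The event mentions only the random sets of the later steps and not the answers, so the
  bound serves every strategy. The factor \<open>s^s\<close> counts all maps from \<open>e0\<close>
  to \<open>f\<close>, which is simpler than counting bijections; an \<open>f\<close> that is not an
  \<open>s\<close>-subset of \<open>[n]\<close> makes the event empty.\<close>

lemma lists_suffix_bound:
  fixes f :: "nat set" and tm :: "'a set \<Rightarrow> nat"
  assumes "r \<le> n" "finite V" "finite E" "\<And>e. e \<in> E \<Longrightarrow> e \<subseteq> V \<and> card e = s" "e0 \<in> E"
    "inj_on tm (E - {e0})" "tm ` (E - {e0}) \<subseteq> {..<T}"
  shows "avg (rsets n r) T (\<lambda>us. of_bool (\<exists>\<phi>. inj_on \<phi> V \<and> \<phi> ` V \<subseteq> {..<n} \<and> \<phi> ` e0 = f \<and>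
             (\<forall>e\<in>E - {e0}. us ! tm e \<subseteq> \<phi> ` e)))
         \<le> real s ^ s * real n ^ (card V - s) * (real (s choose r) / real (n choose r)) ^ (card E - 1)"
proof (cases "card f = s \<and> f \<subseteq> {..<n}")
  case True
  define \<Phi> where "\<Phi> = (\<Pi>\<^sub>E v\<in>V. if v \<in> e0 then f else {..<n})"
  have ff: "finite f" using True finite_subset by blast
  have e0: "e0 \<subseteq> V" "card e0 = s" using assms by auto
  have fin: "finite \<Phi>" unfolding \<Phi>_def using assms ff by (intro finite_PiE) auto
  have cs: "real (card \<Phi>) = real s ^ s * real n ^ (card V - s)"
  proof -
    have "card \<Phi> = (\<Prod>v\<in>V. if v \<in> e0 then s else n)"
      unfolding \<Phi>_def using assms True by (subst card_PiE) (auto intro!: prod.cong)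
    also have "\<dots> = s ^ card e0 * n ^ card (V - e0)"
      using assms e0 by (simp add: prod.If_cases Int_absorb1 Diff_eq)
    also have "card (V - e0) = card V - s"
      using e0 assms by (metis card_Diff_subset finite_subset)
    finally show ?thesis using e0 by simp
  qed
  let ?p = "real (s choose r) / real (n choose r)"
  \<comment> \<open>Indexed by times and not by edges, to fit \<open>avg_nth_in\<close>; injectivity
    of \<open>tm\<close> leaves one edge for each time.\<close>
  let ?Q = "\<lambda>\<phi> us. \<forall>j\<in>tm ` (E - {e0}). us ! j \<in> {U. \<exists>e\<in>E - {e0}. tm e = j \<and> U \<subseteq> \<phi> ` e}"
  have one: "avg (rsets n r) T (\<lambda>us. of_bool (?Q \<phi> us)) \<le> ?p ^ (card E - 1)" for \<phi> :: "'a \<Rightarrow> nat"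
  proof -
    have "avg (rsets n r) T (\<lambda>us. of_bool (?Q \<phi> us))
      = (\<Prod>j\<in>tm ` (E - {e0}). real (card ({U. \<exists>e\<in>E - {e0}. tm e = j \<and> U \<subseteq> \<phi> ` e} \<inter> rsets n r)) / real (card (rsets n r)))"
      using assms by (intro avg_nth_in finite_rsets rsets_nonempty) auto
    also have "\<dots> = (\<Prod>e\<in>E - {e0}. real (card ({U. U \<subseteq> \<phi> ` e} \<inter> rsets n r)) / real (card (rsets n r)))"
    proof -
      have "{U. \<exists>e'\<in>E - {e0}. tm e' = tm e \<and> U \<subseteq> \<phi> ` e'} = {U. U \<subseteq> \<phi> ` e}" if "e \<in> E - {e0}" for e
        using that assms(6) by (auto dest: inj_onD)
      then show ?thesis
        using assms(6) by (subst prod.reindex) (auto intro!: prod.cong)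
    qed
    also have "\<dots> \<le> (\<Prod>e\<in>E - {e0}. ?p)"
    proof (intro prod_mono conjI)
      fix e assume e: "e \<in> E - {e0}"
      have fe: "finite e" using e assms by (metis DiffD1 finite_subset)
      have "card ({U. U \<subseteq> \<phi> ` e} \<inter> rsets n r) \<le> card {U. U \<subseteq> \<phi> ` e \<and> card U = r}"
        using fe by (intro card_mono) (auto simp: rsets_def)
      also have "\<dots> = card (\<phi> ` e) choose r" using fe by (intro n_subsets) auto
      also have "\<dots> \<le> s choose r"
        using fe assms(4) e card_image_le[OF fe, of \<phi>] by (intro binomial_right_mono) auto
      finally show "real (card ({U. U \<subseteq> \<phi> ` e} \<inter> rsets n r)) / real (card (rsets n r)) \<le> ?p"
        by (auto simp: card_rsets intro!: divide_right_mono)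
    qed auto
    also have "\<dots> = ?p ^ (card E - 1)" using assms by simp
    finally show ?thesis .
  qed
  have "avg (rsets n r) T (\<lambda>us. of_bool (\<exists>\<phi>. inj_on \<phi> V \<and> \<phi> ` V \<subseteq> {..<n} \<and> \<phi> ` e0 = f \<and>
             (\<forall>e\<in>E - {e0}. us ! tm e \<subseteq> \<phi> ` e)))
     \<le> avg (rsets n r) T (\<lambda>us. \<Sum>\<phi>\<in>\<Phi>. of_bool (?Q \<phi> us))"
  proof (rule avg_mono)
    fix us :: "nat set list"
    show "of_bool (\<exists>\<phi>. inj_on \<phi> V \<and> \<phi> ` V \<subseteq> {..<n} \<and> \<phi> ` e0 = f \<and>
             (\<forall>e\<in>E - {e0}. us ! tm e \<subseteq> \<phi> ` e)) \<le> (\<Sum>\<phi>\<in>\<Phi>. of_bool (?Q \<phi> us) :: real)"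
    proof (rule of_bool_le_sum[OF fin])
      assume "\<exists>\<phi>. inj_on \<phi> V \<and> \<phi> ` V \<subseteq> {..<n} \<and> \<phi> ` e0 = f \<and> (\<forall>e\<in>E - {e0}. us ! tm e \<subseteq> \<phi> ` e)"
      then obtain \<phi> where \<phi>: "\<phi> ` V \<subseteq> {..<n}" "\<phi> ` e0 = f" "\<forall>e\<in>E - {e0}. us ! tm e \<subseteq> \<phi> ` e" by blast
      define \<psi> where "\<psi> = restrict \<phi> V"
      have "\<psi> \<in> \<Phi>" using \<phi> by (auto simp: \<psi>_def \<Phi>_def)
      moreover have img: "\<psi> ` e = \<phi> ` e" if "e \<in> E" for e
      proof -
        have "e \<subseteq> V" using assms that by auto
        then show ?thesis unfolding \<psi>_def by (intro image_cong) auto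
      qed
      moreover have "?Q \<psi> us"
      proof
        fix j assume "j \<in> tm ` (E - {e0})"
        then obtain e where e: "e \<in> E - {e0}" "j = tm e" by blast
        then have "us ! j \<subseteq> \<psi> ` e" using img[of e] \<phi>(3) by auto
        then show "us ! j \<in> {U. \<exists>e\<in>E - {e0}. tm e = j \<and> U \<subseteq> \<psi> ` e}" using e by blast
      qed
      ultimately show "\<exists>\<psi>\<in>\<Phi>. ?Q \<psi> us" by blast
    qed
  qed
  also have "\<dots> \<le> (\<Sum>\<phi>\<in>\<Phi>. ?p ^ (card E - 1))"
    unfolding avg_sum by (intro sum_mono one)
  finally show ?thesis using cs by simp
next
  case False
  have "\<not> (inj_on \<phi> V \<and> \<phi> ` V \<subseteq> {..<n} \<and> \<phi> ` e0 = f)" for \<phi>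
  proof
    assume a: "inj_on \<phi> V \<and> \<phi> ` V \<subseteq> {..<n} \<and> \<phi> ` e0 = f"
    have "e0 \<subseteq> V" "card e0 = s" using assms by auto
    then have "card f = s" "f \<subseteq> {..<n}" using a card_image[of \<phi> e0] inj_on_subset[of \<phi> V e0] by auto
    then show False using False by simp
  qed
  then have "\<not> (\<exists>\<phi>. inj_on \<phi> V \<and> \<phi> ` V \<subseteq> {..<n} \<and> \<phi> ` e0 = f \<and>
             (\<forall>e\<in>E - {e0}. us ! tm e \<subseteq> \<phi> ` e))" for us by blast
  then show ?thesis by (simp only: of_bool_eq avg_zero) simp
qed

text \<open>Union bound over the assignments of edges to the steps that created them. Distinct edges
  of \<open>H\<close> have distinct images, so only injective assignments occur, and this gives each
  later edge its own independent random set.\<close>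

lemma prob_copy_le:
  assumes "r \<le> n" "finite V" "\<And>e. e \<in> E \<Longrightarrow> e \<subseteq> V \<and> card e = s" "E \<noteq> {}"
  shows "prob_copy r \<sigma> n t V E
     \<le> real t ^ card E * (real s ^ s * real n ^ (card V - s) * (real (s choose r) / real (n choose r)) ^ (card E - 1))"
    (is "_ \<le> _ * ?B")
proof -
  let ?R = "rsets n r"
  have fE: "finite E" by (rule finite_subset[of _ "Pow V"]) (use assms in auto)
  define Ps where "Ps = {\<pi> \<in> E \<rightarrow>\<^sub>E {..<t}. inj_on \<pi> E}"
  have fin: "finite Ps" unfolding Ps_def using fE by (auto intro!: finite_PiE)
  have cP: "card Ps \<le> t ^ card E"
  proof -
    have "card Ps \<le> card (E \<rightarrow>\<^sub>E {..<t})"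
      unfolding Ps_def using fE by (intro card_mono finite_PiE) auto
    then show ?thesis using fE by (simp add: card_PiE)
  qed
  let ?H = "\<lambda>\<pi> Us. \<exists>\<phi>. inj_on \<phi> V \<and> \<phi> ` V \<subseteq> {..<n} \<and> (\<forall>e\<in>E. \<phi> ` e = graph_edges \<sigma> n Us ! \<pi> e)"
  have one: "avg ?R t (\<lambda>Us. of_bool (?H \<pi> Us)) \<le> ?B" if \<pi>: "\<pi> \<in> Ps" for \<pi>
  proof -
    obtain e0 where e0: "e0 \<in> E" "\<And>e. e \<in> E \<Longrightarrow> \<pi> e0 \<le> \<pi> e"
      using ex_min_if_finite[of "\<pi> ` E"] fE assms(4) by (auto simp: not_less)
    have inj: "inj_on \<pi> E" and less: "\<And>e. e \<in> E \<Longrightarrow> \<pi> e < t" using \<pi> by (auto simp: Ps_def)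
    have gt: "\<pi> e0 < \<pi> e" if "e \<in> E - {e0}" for e
      using e0(2)[of e] inj e0(1) that by (metis DiffD1 DiffD2 inj_onD insertI1 le_neq_implies_less)
    \<comment> \<open>The prefix ends with the step of \<open>e0\<close>, its answer included, so it
      determines the edge \<open>f\<close>; the remaining times are counted from there.\<close>
    define T where "T = t - Suc (\<pi> e0)"
    have t: "t = Suc (\<pi> e0) + T" using less[OF e0(1)] by (simp add: T_def)
    define tm where "tm e = \<pi> e - Suc (\<pi> e0)" for e
    have inj': "inj_on tm (E - {e0})"
    proof (rule inj_onI)
      fix e e' assume "e \<in> E - {e0}" "e' \<in> E - {e0}" "tm e = tm e'"
      then show "e = e'" using gt[of e] gt[of e'] inj by (auto simp: tm_def inj_on_def)
    qed
    have sub: "tm ` (E - {e0}) \<subseteq> {..<T}"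
    proof (rule image_subsetI)
      fix e assume "e \<in> E - {e0}"
      then show "tm e \<in> {..<T}" using gt[of e] less[of e] by (auto simp: tm_def T_def)
    qed
    have "avg ?R t (\<lambda>Us. of_bool (?H \<pi> Us))
        = avg ?R (Suc (\<pi> e0)) (\<lambda>xs. avg ?R T (\<lambda>ys. of_bool (?H \<pi> (xs @ ys))))"
      unfolding t by (rule avg_add)
    also have "\<dots> \<le> avg ?R (Suc (\<pi> e0)) (\<lambda>xs. ?B)"
    proof (rule avg_mono)
      fix xs :: "nat set list" assume xs: "set xs \<subseteq> ?R" "length xs = Suc (\<pi> e0)"
      define f where "f = graph_edges \<sigma> n xs ! \<pi> e0"
      have "avg ?R T (\<lambda>ys. of_bool (?H \<pi> (xs @ ys))) \<le> avg ?R T (\<lambda>us. of_bool (\<exists>\<phi>. inj_on \<phi> V \<and> \<phi> ` V \<subseteq> {..<n} \<and> \<phi> ` e0 = f \<and>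
             (\<forall>e\<in>E - {e0}. us ! tm e \<subseteq> \<phi> ` e)))"
      proof (rule avg_mono)
        fix ys :: "nat set list" assume ys: "length ys = T"
        have 1: "graph_edges \<sigma> n (xs @ ys) ! \<pi> e0 = f"
          using xs by (simp add: nth_graph_edges f_def nth_append)
        have 2: "ys ! tm e \<subseteq> graph_edges \<sigma> n (xs @ ys) ! \<pi> e" if "e \<in> E - {e0}" for e
          using gt[OF that] less[of e] that xs ys t by (auto simp: nth_graph_edges nth_append tm_def)
        show "of_bool (?H \<pi> (xs @ ys)) \<le> (of_bool (\<exists>\<phi>. inj_on \<phi> V \<and> \<phi> ` V \<subseteq> {..<n} \<and> \<phi> ` e0 = f \<and>
             (\<forall>e\<in>E - {e0}. ys ! tm e \<subseteq> \<phi> ` e)) :: real)"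
        proof (rule of_bool_mono)
          assume "?H \<pi> (xs @ ys)"
          then obtain \<phi> where \<phi>: "inj_on \<phi> V" "\<phi> ` V \<subseteq> {..<n}"
            "\<forall>e\<in>E. \<phi> ` e = graph_edges \<sigma> n (xs @ ys) ! \<pi> e" by (elim exE conjE)
          have "\<phi> ` e0 = f" using bspec[OF \<phi>(3) e0(1)] 1 by (rule trans)
          moreover have "ys ! tm e \<subseteq> \<phi> ` e" if "e \<in> E - {e0}" for e
            using 2[OF that] bspec[OF \<phi>(3), of e] that by simp
          ultimately show "\<exists>\<phi>. inj_on \<phi> V \<and> \<phi> ` V \<subseteq> {..<n} \<and> \<phi> ` e0 = f \<and>
             (\<forall>e\<in>E - {e0}. ys ! tm e \<subseteq> \<phi> ` e)" using \<phi>(1,2) by (intro exI[of _ \<phi>] conjI ballI)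
        qed
      qed
      also have "\<dots> \<le> ?B" by (rule lists_suffix_bound[OF assms(1,2) fE assms(3) e0(1) inj' sub])
      finally show "avg ?R T (\<lambda>ys. of_bool (?H \<pi> (xs @ ys))) \<le> ?B" .
    qed
    also have "\<dots> = ?B" using assms(1) by (intro avg_const finite_rsets rsets_nonempty)
    finally show ?thesis .
  qed
  have "prob_copy r \<sigma> n t V E \<le> avg ?R t (\<lambda>Us. \<Sum>\<pi>\<in>Ps. of_bool (?H \<pi> Us))"
    unfolding prob_copy_avg
  proof (rule avg_mono)
    fix Us :: "nat set list" assume Us: "length Us = t"
    show "of_bool (has_copy n V E (graph_edges \<sigma> n Us)) \<le> (\<Sum>\<pi>\<in>Ps. of_bool (?H \<pi> Us) :: real)"
    proof (rule of_bool_le_sum[OF fin])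
      assume "has_copy n V E (graph_edges \<sigma> n Us)"
      then obtain \<phi> where \<phi>: "inj_on \<phi> V" "\<phi> ` V \<subseteq> {..<n}" "\<forall>e\<in>E. \<phi> ` e \<in> set (graph_edges \<sigma> n Us)"
        by (auto simp: has_copy_def)
      have "\<forall>e\<in>E. \<exists>i. i < t \<and> \<phi> ` e = graph_edges \<sigma> n Us ! i"
      proof
        fix e assume "e \<in> E"
        then have "\<phi> ` e \<in> set (graph_edges \<sigma> n Us)" using \<phi>(3) by blast
        then show "\<exists>i. i < t \<and> \<phi> ` e = graph_edges \<sigma> n Us ! i"
          using Us unfolding in_set_conv_nth length_graph_edges by auto
      qed
      from bchoice[OF this] obtain \<pi>0 where
        \<pi>0: "\<forall>e\<in>E. \<pi>0 e < t \<and> \<phi> ` e = graph_edges \<sigma> n Us ! \<pi>0 e" ..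
      define \<pi> where "\<pi> = restrict \<pi>0 E"
      have \<pi>: "\<forall>e\<in>E. \<pi> e < t" "\<forall>e\<in>E. \<phi> ` e = graph_edges \<sigma> n Us ! \<pi> e"
        using \<pi>0 by (simp_all add: \<pi>_def)
      have "inj_on \<pi> E"
      proof (rule inj_onI)
        fix e e' assume e: "e \<in> E" "e' \<in> E" "\<pi> e = \<pi> e'"
        then have "\<phi> ` e = \<phi> ` e'" using bspec[OF \<pi>(2) e(1)] bspec[OF \<pi>(2) e(2)] by (simp only:)
        then show "e = e'"
          using inj_on_image_eq_iff[OF \<phi>(1), of e e'] assms(3)[OF e(1)] assms(3)[OF e(2)] by (simp only:)
      qed
      then have "\<pi> \<in> Ps" using \<pi>(1) by (auto simp: Ps_def \<pi>_def)
      moreover have "?H \<pi> Us" using \<pi>(2) \<phi>(1,2) by (intro exI[of _ \<phi>] conjI)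
      ultimately show "\<exists>\<pi>\<in>Ps. ?H \<pi> Us" by blast
    qed
  qed
  also have "\<dots> \<le> (\<Sum>\<pi>\<in>Ps. ?B)" unfolding avg_sum by (intro sum_mono one)
  also have "\<dots> = real (card Ps) * ?B" by simp
  also have "\<dots> \<le> real (t ^ card E) * ?B"
    using cP by (intro mult_right_mono) (auto simp del: of_nat_power)
  finally show ?thesis by simp
qed

lemma prob_copy_nonneg: "0 \<le> prob_copy r \<sigma> n t V E"
  by (simp add: prob_copy_def)

lemma prob_copy_le_1:
  assumes "r \<le> n" shows "prob_copy r \<sigma> n t V E \<le> 1"
proof -
  have "prob_copy r \<sigma> n t V E \<le> avg (rsets n r) t (\<lambda>_. 1)"
    unfolding prob_copy_avg by (intro avg_mono) auto
  then show ?thesis using assms by (simp add: avg_const finite_rsets rsets_nonempty)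
qed

text \<open>The exponent turns the union bound into a constant times \<open>(t / f)^e\<close> for
  \<open>e\<close> edges: multiplied by \<open>e\<close> it is
  \<open>r (e - 1) - (card V - s)\<close>, which balances the free vertices against the
  \<open>e - 1\<close> later edges.\<close>

lemma general_lower_bound:
  assumes "1 \<le> r" "finite V" "\<And>e. e \<in> E \<Longrightarrow> e \<subseteq> V \<and> card e = s" "E \<noteq> {}" "s \<le> card V"
  shows "tau_lower r s V E (\<lambda>n. real n powr (real r - real (card V - s + r) / real (card E)))"
  unfolding tau_lower_def
proof (intro allI impI)
  fix \<sigma> and t :: "nat \<Rightarrow> nat"
  let ?f = "\<lambda>n. real n powr (real r - real (card V - s + r) / real (card E))"
  assume t: "(\<lambda>n. real (t n)) \<in> o(?f)"
  have "finite E" by (rule finite_subset[of _ "Pow V"]) (use assms in auto)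
  then have cE: "card E > 0" using assms(4) by (simp add: card_gt_0_iff)
  define c where "c = real s ^ s * (real (s choose r) * real r ^ r) ^ (card E - 1)"
  have lim: "((\<lambda>n. c * (real (t n) / ?f n) ^ card E) \<longlongrightarrow> 0) sequentially"
    using tendsto_mult_left[OF tendsto_power[OF smalloD_tendsto[OF t], of "card E"], of c] cE by (simp add: zero_power)
  show "((\<lambda>n. prob_copy r \<sigma> n (t n) V E) \<longlongrightarrow> 0) sequentially"
  proof (rule tendsto_sandwich[OF _ _ tendsto_const lim])
    show "\<forall>\<^sub>F n in sequentially. 0 \<le> prob_copy r \<sigma> n (t n) V E" by (simp add: prob_copy_nonneg)
    show "\<forall>\<^sub>F n in sequentially. prob_copy r \<sigma> n (t n) V E \<le> c * (real (t n) / ?f n) ^ card E"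
    proof (rule eventually_mono[OF eventually_ge_at_top[of "max 1 r"]])
      fix n assume n: "max 1 r \<le> n"
      let ?N = "real n"
      have "(?N / r) ^ r \<le> n choose r" using n by (intro binomial_ge_n_over_k_pow_k) auto
      then have "real (s choose r) / real (n choose r) \<le> real (s choose r) / (?N / r) ^ r"
        using n assms(1) by (intro divide_left_mono) auto
      also have "\<dots> = real (s choose r) * real r ^ r / ?N ^ r" by (simp add: power_divide)
      finally have b: "(real (s choose r) / real (n choose r)) ^ (card E - 1)
          \<le> (real (s choose r) * real r ^ r / ?N ^ r) ^ (card E - 1)"
        by (intro power_mono) auto
      have "prob_copy r \<sigma> n (t n) V E
         \<le> real (t n) ^ card E * (real s ^ s * ?N ^ (card V - s) * (real (s choose r) / real (n choose r)) ^ (card E - 1))"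
        using n assms by (intro prob_copy_le) auto
      also have "\<dots> \<le> real (t n) ^ card E * (real s ^ s * ?N ^ (card V - s) * (real (s choose r) * real r ^ r / ?N ^ r) ^ (card E - 1))"
        by (intro mult_left_mono b) auto
      also have "\<dots> = c * (real (t n) ^ card E * (?N ^ (card V - s) / ?N ^ (r * (card E - 1))))"
        by (simp add: c_def power_divide power_mult)
      also have "?N ^ (card V - s) / ?N ^ (r * (card E - 1)) = 1 / ?f n ^ card E"
      proof -
        have "?f n ^ card E = ?N powr (real (card E) * (real r - real (card V - s + r) / real (card E)))"
          using n by (subst powr_power) (auto simp: mult.commute)
        also have "real (card E) * (real r - real (card V - s + r) / real (card E)) = real (r * (card E - 1)) - real (card V - s)"
          using cE by (simp add: field_simps of_nat_diff Suc_leI)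
        finally show ?thesis using n by (simp add: powr_diff powr_realpow del: of_nat_mult of_nat_diff)
      qed
      finally show "prob_copy r \<sigma> n (t n) V E \<le> c * (real (t n) / ?f n) ^ card E"
        by (simp add: power_divide)
    qed
  qed
qed

subsection \<open>Second moments over time blocks\<close>

definition blk :: "nat \<Rightarrow> nat \<Rightarrow> 'b list \<Rightarrow> 'b list" where
  "blk T i us = take T (drop (i * T) us)"

definition hits :: "nat \<Rightarrow> nat \<Rightarrow> (nat \<Rightarrow> 'b) \<Rightarrow> 'b list \<Rightarrow> bool" where
  "hits L T \<rho> us \<longleftrightarrow> (\<forall>i<L. \<rho> i \<in> set (blk T i us))"

definition hitp :: "'b set \<Rightarrow> nat \<Rightarrow> real" where
  "hitp R T = 1 - (1 - 1 / real (card R)) ^ T"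

lemma avg_blocks:
  "avg R (L * T) (\<lambda>us. \<Prod>i<L. g i (blk T i us)) = (\<Prod>i<L. avg R T (g i))"
proof (induction L)
  case (Suc L)
  have "avg R (Suc L * T) (\<lambda>us. \<Prod>i<Suc L. g i (blk T i us))
     = avg R (L * T) (\<lambda>xs. avg R T (\<lambda>ys. \<Prod>i<Suc L. g i (blk T i (xs @ ys))))"
    using avg_add[of R "L * T" T] by (simp add: add.commute)
  also have "\<dots> = avg R (L * T) (\<lambda>xs. avg R T (\<lambda>ys. (\<Prod>i<L. g i (blk T i xs)) * g L ys))"
  proof (intro avg_cong)
    fix xs ys :: "'a list" assume l: "length xs = L * T" "length ys = T"
    have "blk T i (xs @ ys) = blk T i xs" if "i < L" for i
    proof -
      have "Suc i * T \<le> L * T" using that by (intro mult_right_mono) auto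
      then show ?thesis using l by (simp add: blk_def)
    qed
    then have "(\<Prod>i<L. g i (blk T i (xs @ ys))) = (\<Prod>i<L. g i (blk T i xs))"
      by (intro prod.cong) simp_all
    moreover have "blk T L (xs @ ys) = ys" using l by (simp add: blk_def)
    ultimately show "(\<Prod>i<Suc L. g i (blk T i (xs @ ys))) = (\<Prod>i<L. g i (blk T i xs)) * g L ys"
      by simp
  qed
  finally show ?case by (simp add: avg_cmult avg_multc Suc.IH)
qed auto

context
  fixes R :: "'b set"
  assumes finR: "finite R" and neR: "R \<noteq> {}"
begin

lemma card_R_pos: "real (card R) > 0"
  using finR neR by (simp add: card_gt_0_iff)

lemma avg_avoid:
  assumes "X \<subseteq> R"
  shows "avg R T (\<lambda>us. of_bool (\<forall>x\<in>X. x \<notin> set us)) = (1 - real (card X) / real (card R)) ^ T"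
proof -
  have "avg R T (\<lambda>us. of_bool (\<forall>x\<in>X. x \<notin> set us)) = avg R T (\<lambda>us. of_bool (\<forall>i\<in>{..<T}. us ! i \<in> - X))"
    by (intro avg_cong) (auto simp: in_set_conv_nth)
  also have "\<dots> = (\<Prod>i\<in>{..<T}. real (card (- X \<inter> R)) / real (card R))"
    by (intro avg_nth_in finR neR) auto
  also have "- X \<inter> R = R - X" by auto
  also have "real (card (R - X)) = real (card R) - real (card X)"
    using assms finR by (simp add: card_Diff_subset finite_subset of_nat_diff card_mono)
  finally show ?thesis using card_R_pos by (simp add: diff_divide_distrib)
qed

lemma hitp_bounds: "0 \<le> hitp R T" "hitp R T \<le> 1"
proof -
  have "1 / real (card R) \<le> 1" using card_R_pos by (simp add: field_simps Suc_le_eq)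
  then have "0 \<le> 1 - 1 / real (card R)" "1 - 1 / real (card R) \<le> 1" by auto
  then show "0 \<le> hitp R T" "hitp R T \<le> 1" unfolding hitp_def by (auto simp: power_le_one)
qed

lemma avg_diff: "avg R T (\<lambda>us. f us - g us) = avg R T f - avg R T g"
  using avg_plus[of R T f "\<lambda>us. - 1 * g us"] unfolding avg_cmult by simp

lemma avg_hit:
  assumes "x \<in> R"
  shows "avg R T (\<lambda>us. of_bool (x \<in> set us)) = hitp R T"
proof -
  have "avg R T (\<lambda>us. of_bool (x \<in> set us)) = avg R T (\<lambda>us. 1 - of_bool (\<forall>x\<in>{x}. x \<notin> set us))"
    by (intro avg_cong) auto
  then show ?thesis
    using avg_avoid[of "{x}" T] assms by (simp add: avg_diff avg_const finR neR hitp_def)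
qed

text \<open>Two different elements compete for the same draws, so their hits are negatively
  correlated. After inclusion-exclusion this is \<open>1 - 2/M <= (1 - 1/M)^2\<close> for
  \<open>M = card R\<close>.\<close>

lemma avg_hit_both:
  assumes "x \<in> R" "y \<in> R" "x \<noteq> y"
  shows "avg R T (\<lambda>us. of_bool (x \<in> set us) * of_bool (y \<in> set us)) \<le> (hitp R T)\<^sup>2"
proof -
  let ?M = "real (card R)" and ?a = "1 - 1 / real (card R)"
  have "card {x, y} \<le> card R" using assms finR by (intro card_mono) auto
  \<comment> \<open>This keeps the base \<open>1 - 2/M\<close> nonnegative, as monotonicity of
    powers requires.\<close>
  then have M: "?M \<ge> 2" using assms by simp
  have "avg R T (\<lambda>us. of_bool (x \<in> set us) * of_bool (y \<in> set us))
     = avg R T (\<lambda>us. 1 - of_bool (\<forall>z\<in>{x}. z \<notin> set us) - (of_bool (\<forall>z\<in>{y}. z \<notin> set us) - of_bool (\<forall>z\<in>{x, y}. z \<notin> set us)))"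
    by (intro avg_cong) auto
  also have "\<dots> = 1 - ?a ^ T - (?a ^ T - (1 - 2 / ?M) ^ T)"
    unfolding avg_diff using assms avg_avoid[of "{x}" T] avg_avoid[of "{y}" T] avg_avoid[of "{x, y}" T]
    by (simp add: avg_const finR neR)
  also have "(1 - 2 / ?M) ^ T \<le> (?a\<^sup>2) ^ T"
    using M by (intro power_mono) (auto simp: power2_eq_square field_simps)
  also have "1 - ?a ^ T - (?a ^ T - (?a\<^sup>2) ^ T) = (hitp R T)\<^sup>2"
  proof -
    have "(?a\<^sup>2) ^ T = (?a ^ T)\<^sup>2" by (simp flip: power_mult add: mult.commute)
    then show ?thesis by (simp only: hitp_def power2_eq_square) (simp add: algebra_simps)
  qed
  finally show ?thesis by simp
qed

lemma of_bool_hits: "of_bool (hits L T \<rho> us) = (\<Prod>i<L. of_bool (\<rho> i \<in> set (blk T i us)) :: real)"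
  by (auto simp: hits_def of_bool_Ball_prod)

lemma avg_hits:
  assumes "\<And>i. i < L \<Longrightarrow> \<rho> i \<in> R"
  shows "avg R (L * T) (\<lambda>us. of_bool (hits L T \<rho> us)) = hitp R T ^ L"
  using assms avg_blocks[of R L T "\<lambda>i us. of_bool (\<rho> i \<in> set us)"] by (simp add: of_bool_hits avg_hit)

text \<open>A slot where both ask for the same element costs one factor \<open>hitp R T\<close>; any
  other slot costs two, by negative correlation.\<close>

lemma avg_hits_both:
  assumes "\<And>i. i < L \<Longrightarrow> \<rho> i \<in> R" "\<And>i. i < L \<Longrightarrow> \<sigma> i \<in> R"
  shows "avg R (L * T) (\<lambda>us. of_bool (hits L T \<rho> us \<and> hits L T \<sigma> us))
     \<le> hitp R T ^ (2 * L - card {i. i < L \<and> \<rho> i = \<sigma> i})"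
proof -
  let ?q = "hitp R T"
  let ?S = "{i. i < L \<and> \<rho> i = \<sigma> i}"
  have "avg R (L * T) (\<lambda>us. of_bool (hits L T \<rho> us \<and> hits L T \<sigma> us))
     = avg R (L * T) (\<lambda>us. \<Prod>i<L. of_bool (\<rho> i \<in> set (blk T i us)) * of_bool (\<sigma> i \<in> set (blk T i us)))"
    by (simp add: of_bool_conj of_bool_hits prod.distrib)
  also have "\<dots> = (\<Prod>i<L. avg R T (\<lambda>us. of_bool (\<rho> i \<in> set us) * of_bool (\<sigma> i \<in> set us)))"
    by (rule avg_blocks[where g = "\<lambda>i us. of_bool (\<rho> i \<in> set us) * of_bool (\<sigma> i \<in> set us)"])
  also have "\<dots> \<le> (\<Prod>i<L. if i \<in> ?S then ?q else ?q\<^sup>2)"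
  proof (intro prod_mono conjI)
    fix i assume "i \<in> {..<L}"
    then have i: "i < L" by simp
    have "avg R T (\<lambda>us. 0) \<le> avg R T (\<lambda>us. of_bool (\<rho> i \<in> set us) * of_bool (\<sigma> i \<in> set us))"
      by (intro avg_mono) auto
    then show "0 \<le> avg R T (\<lambda>us. of_bool (\<rho> i \<in> set us) * of_bool (\<sigma> i \<in> set us))"
      by (simp add: avg_zero)
    show "avg R T (\<lambda>us. of_bool (\<rho> i \<in> set us) * of_bool (\<sigma> i \<in> set us)) \<le> (if i \<in> ?S then ?q else ?q\<^sup>2)"
    proof (cases "\<rho> i = \<sigma> i")
      case True
      have "avg R T (\<lambda>us. of_bool (\<rho> i \<in> set us) * of_bool (\<sigma> i \<in> set us)) = avg R T (\<lambda>us. of_bool (\<rho> i \<in> set us))"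
        using True by (intro avg_cong) auto
      then show ?thesis using True i assms by (simp add: avg_hit)
    next
      case False
      then show ?thesis using i avg_hit_both[OF assms(1)[OF i] assms(2)[OF i]] by auto
    qed
  qed
  also have "\<dots> = ?q ^ (card ?S) * (?q\<^sup>2) ^ card ({..<L} - ?S)"
  proof -
    have "{..<L} \<inter> {i. i \<in> ?S} = ?S" "{..<L} \<inter> - {i. i \<in> ?S} = {..<L} - ?S" by auto
    then show ?thesis by (simp only: prod.If_cases[OF finite_lessThan] prod_constant)
  qed
  also have "\<dots> = ?q ^ (2 * L - card ?S)"
  proof -
    have c: "card ?S \<le> L" using card_mono[of "{..<L}" ?S] by auto
    have "card ({..<L} - ?S) = L - card ?S" by (subst card_Diff_subset) auto
    then have "card ?S + 2 * card ({..<L} - ?S) = 2 * L - card ?S" using c by simp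
    then show ?thesis by (simp flip: power_add power_mult)
  qed
  finally show ?thesis .
qed

text \<open>Each pair has one exact set of agreeing slots, but the sum runs over all sets
  \<open>I\<close> on which it agrees. The surplus terms are nonnegative, and pairs that agree at
  least on \<open>I\<close> are easier to count than pairs that agree exactly there.\<close>

lemma avg_pairs_le:
  assumes "finite D" "\<And>x y i. (x, y) \<in> D \<Longrightarrow> i < L \<Longrightarrow> \<rho> i x \<in> R \<and> \<rho> i y \<in> R"
  shows "avg R (L * T) (\<lambda>us. real (card {(x, y) \<in> D. hits L T (\<lambda>i. \<rho> i x) us \<and> hits L T (\<lambda>i. \<rho> i y) us}))
    \<le> (\<Sum>I\<in>Pow {..<L}. hitp R T ^ (2 * L - card I) * real (card {(x, y) \<in> D. \<forall>i\<in>I. \<rho> i x = \<rho> i y}))"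
proof -
  let ?q = "hitp R T"
  let ?S = "\<lambda>x y. {i. i < L \<and> \<rho> i x = \<rho> i y}"
  have cs: "real (card {(x, y) \<in> D. Q x y}) = (\<Sum>(x, y)\<in>D. of_bool (Q x y))" for Q :: "'a \<Rightarrow> 'a \<Rightarrow> bool"
  proof -
    have "(\<Sum>(x, y)\<in>D. of_bool (Q x y)) = (\<Sum>p\<in>D. of_bool (Q (fst p) (snd p)) :: real)"
      by (simp add: case_prod_beta)
    also have "\<dots> = real (card (D \<inter> {p. Q (fst p) (snd p)}))"
      using assms(1) by (simp add: of_bool_def sum.If_cases)
    also have "D \<inter> {p. Q (fst p) (snd p)} = {(x, y) \<in> D. Q x y}" by auto
    finally show ?thesis ..
  qed
  have "avg R (L * T) (\<lambda>us. real (card {(x, y) \<in> D. hits L T (\<lambda>i. \<rho> i x) us \<and> hits L T (\<lambda>i. \<rho> i y) us}))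
    = (\<Sum>p\<in>D. avg R (L * T) (\<lambda>us. of_bool (hits L T (\<lambda>i. \<rho> i (fst p)) us \<and> hits L T (\<lambda>i. \<rho> i (snd p)) us)))"
    unfolding cs case_prod_beta avg_sum ..
  also have "\<dots> \<le> (\<Sum>p\<in>D. ?q ^ (2 * L - card (?S (fst p) (snd p))))"
    using assms(2) by (intro sum_mono avg_hits_both) auto
  also have "\<dots> \<le> (\<Sum>p\<in>D. \<Sum>I\<in>Pow {..<L}. ?q ^ (2 * L - card I) * of_bool (\<forall>i\<in>I. \<rho> i (fst p) = \<rho> i (snd p)))"
  proof (rule sum_mono)
    fix p
    let ?f = "\<lambda>I. ?q ^ (2 * L - card I) * of_bool (\<forall>i\<in>I. \<rho> i (fst p) = \<rho> i (snd p))"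
    have "?f (?S (fst p) (snd p)) \<le> (\<Sum>I\<in>Pow {..<L}. ?f I)"
      using hitp_bounds(1)[of T] by (intro member_le_sum) auto
    then show "?q ^ (2 * L - card (?S (fst p) (snd p))) \<le> (\<Sum>I\<in>Pow {..<L}. ?f I)" by simp
  qed
  also have "\<dots> = (\<Sum>I\<in>Pow {..<L}. ?q ^ (2 * L - card I) * (\<Sum>p\<in>D. of_bool (\<forall>i\<in>I. \<rho> i (fst p) = \<rho> i (snd p))))"
    unfolding sum_distrib_left by (rule sum.swap)
  finally show ?thesis unfolding cs case_prod_beta .
qed

lemma chebyshev_half:
  assumes "\<mu> > 0" "avg R T X = \<mu>" "avg R T (\<lambda>us. (X us)\<^sup>2) \<le> \<mu>\<^sup>2 + v"
  shows "avg R T (\<lambda>us. of_bool (X us \<le> \<mu> / 2)) \<le> 4 * v / \<mu>\<^sup>2"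
proof -
  have "avg R T (\<lambda>us. of_bool (X us \<le> \<mu> / 2)) \<le> avg R T (\<lambda>us. 4 / \<mu>\<^sup>2 * ((X us)\<^sup>2 - (2 * \<mu> * X us - \<mu>\<^sup>2)))"
  proof (rule avg_mono)
    fix us
    have "(X us)\<^sup>2 - (2 * \<mu> * X us - \<mu>\<^sup>2) = (\<mu> - X us)\<^sup>2" by (simp add: power2_eq_square algebra_simps)
    moreover have "of_bool (X us \<le> \<mu> / 2) \<le> 4 / \<mu>\<^sup>2 * (\<mu> - X us)\<^sup>2"
    proof (cases "X us \<le> \<mu> / 2")
      case True
      have "1 = 4 / \<mu>\<^sup>2 * (\<mu> / 2)\<^sup>2" using assms(1) by (simp add: power2_eq_square)
      also have "\<dots> \<le> 4 / \<mu>\<^sup>2 * (\<mu> - X us)\<^sup>2"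
        using True assms(1) by (intro mult_left_mono power_mono) auto
      finally show ?thesis using True by simp
    qed simp
    ultimately show "of_bool (X us \<le> \<mu> / 2) \<le> 4 / \<mu>\<^sup>2 * ((X us)\<^sup>2 - (2 * \<mu> * X us - \<mu>\<^sup>2))"
      by (simp only:)
  qed
  also have "\<dots> = 4 / \<mu>\<^sup>2 * (avg R T (\<lambda>us. (X us)\<^sup>2) - \<mu>\<^sup>2)"
    unfolding avg_cmult avg_diff using assms(2) by (simp add: avg_const finR neR power2_eq_square)
  also have "\<dots> \<le> 4 / \<mu>\<^sup>2 * v" using assms by (intro mult_left_mono) auto
  finally show ?thesis by simp
qed

lemma markov:
  assumes "c > 0" "\<And>us. X us \<ge> 0"
  shows "avg R T (\<lambda>us. of_bool (X us > c)) \<le> avg R T X / c"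
proof -
  have "avg R T (\<lambda>us. of_bool (X us > c)) \<le> avg R T (\<lambda>us. 1 / c * X us)"
    using assms by (intro avg_mono) (auto simp: of_bool_def field_simps)
  then show ?thesis unfolding avg_cmult by simp
qed

lemma card_hits_sum:
  "finite P \<Longrightarrow> real (card {x \<in> P. Q x}) = (\<Sum>x\<in>P. of_bool (Q x))"
  by (simp add: of_bool_def sum.If_cases Int_def)

lemma avg_card_hits:
  assumes "finite P" "\<And>x i. x \<in> P \<Longrightarrow> i < L \<Longrightarrow> \<rho> i x \<in> R"
  shows "avg R (L * T) (\<lambda>us. real (card {x \<in> P. hits L T (\<lambda>i. \<rho> i x) us})) = real (card P) * hitp R T ^ L"
proof -
  have "(\<Sum>x\<in>P. avg R (L * T) (\<lambda>us. of_bool (hits L T (\<lambda>i. \<rho> i x) us))) = (\<Sum>x\<in>P. hitp R T ^ L)"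
    using assms(2) by (intro sum.cong refl avg_hits)
  then show ?thesis unfolding card_hits_sum[OF assms(1)] avg_sum by simp
qed

lemma card_hits_square:
  assumes "finite P"
  shows "(real (card {x \<in> P. Q x}))\<^sup>2 = real (card {(x, y) \<in> P \<times> P. Q x \<and> Q y})"
proof -
  have "{(x, y) \<in> P \<times> P. Q x \<and> Q y} = {x \<in> P. Q x} \<times> {x \<in> P. Q x}" by auto
  then show ?thesis by (simp add: card_cartesian_product power2_eq_square)
qed

text \<open>By injectivity different members of \<open>F\<close> never ask for the same element in
  the same slot. Hence they are not positively correlated, the variance of the number of hit members
  is at most its mean, and Chebyshev applies.\<close>

lemma avg_no_hit_disjoint:
  assumes "finite F" "F \<noteq> {}" "hitp R T > 0" "\<And>x i. x \<in> F \<Longrightarrow> i < L \<Longrightarrow> \<rho> i x \<in> R"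
    and inj: "\<And>i. i < L \<Longrightarrow> inj_on (\<rho> i) F"
  shows "avg R (L * T) (\<lambda>us. of_bool (\<forall>x\<in>F. \<not> hits L T (\<lambda>i. \<rho> i x) us)) \<le> 4 / (real (card F) * hitp R T ^ L)"
proof -
  let ?q = "hitp R T" and ?N = "real (card F)"
  let ?X = "\<lambda>us. real (card {x \<in> F. hits L T (\<lambda>i. \<rho> i x) us})"
  let ?\<mu> = "?N * ?q ^ L"
  have N: "?N > 0" using assms by (simp add: card_gt_0_iff)
  then have \<mu>: "?\<mu> > 0" using assms by simp
  have e: "avg R (L * T) ?X = ?\<mu>" using assms by (intro avg_card_hits) auto
  have "avg R (L * T) (\<lambda>us. (?X us)\<^sup>2)
     = (\<Sum>x\<in>F. \<Sum>y\<in>F. avg R (L * T) (\<lambda>us. of_bool (hits L T (\<lambda>i. \<rho> i x) us \<and> hits L T (\<lambda>i. \<rho> i y) us)))"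
    unfolding card_hits_sum[OF assms(1)] power2_eq_square sum_product avg_sum of_bool_conj ..
  also have "\<dots> \<le> (\<Sum>x\<in>F. \<Sum>y\<in>F. ?q ^ (2 * L) + (if x = y then ?q ^ L else 0))"
  proof (intro sum_mono)
    fix x y assume xy: "x \<in> F" "y \<in> F"
    have a: "avg R (L * T) (\<lambda>us. of_bool (hits L T (\<lambda>i. \<rho> i x) us \<and> hits L T (\<lambda>i. \<rho> i y) us))
      \<le> ?q ^ (2 * L - card {i. i < L \<and> \<rho> i x = \<rho> i y})"
      using xy assms by (intro avg_hits_both) auto
    show "avg R (L * T) (\<lambda>us. of_bool (hits L T (\<lambda>i. \<rho> i x) us \<and> hits L T (\<lambda>i. \<rho> i y) us))
      \<le> ?q ^ (2 * L) + (if x = y then ?q ^ L else 0)"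
    proof (cases "x = y")
      case True
      have "0 \<le> ?q ^ (2 * L)" using assms(3) by simp
      moreover have "avg R (L * T) (\<lambda>us. of_bool (hits L T (\<lambda>i. \<rho> i x) us \<and> hits L T (\<lambda>i. \<rho> i y) us)) \<le> ?q ^ L"
        using a True by simp
      ultimately show ?thesis using True by (simp only: refl if_True)
    next
      case False
      then have e: "{i. i < L \<and> \<rho> i x = \<rho> i y} = {}" using inj xy by (auto dest: inj_onD)
      show ?thesis using a False unfolding e by simp
    qed
  qed
  also have "\<dots> = ?\<mu>\<^sup>2 + ?\<mu>"
    using assms(1) by (simp add: sum.distrib power2_eq_square algebra_simps power_mult)
  finally have "avg R (L * T) (\<lambda>us. of_bool (?X us \<le> ?\<mu> / 2)) \<le> 4 * ?\<mu> / ?\<mu>\<^sup>2"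
    by (intro chebyshev_half \<mu> e)
  moreover have "avg R (L * T) (\<lambda>us. of_bool (\<forall>x\<in>F. \<not> hits L T (\<lambda>i. \<rho> i x) us)) \<le> avg R (L * T) (\<lambda>us. of_bool (?X us \<le> ?\<mu> / 2))"
  proof (intro avg_mono of_bool_mono)
    fix us assume "\<forall>x\<in>F. \<not> hits L T (\<lambda>i. \<rho> i x) us"
    then have e: "{x \<in> F. hits L T (\<lambda>i. \<rho> i x) us} = {}" by auto
    show "?X us \<le> ?\<mu> / 2" unfolding e using \<mu> by simp
  qed
  moreover have "4 * ?\<mu> / ?\<mu>\<^sup>2 = 4 / ?\<mu>" using less_imp_neq[OF \<mu>] unfolding power2_eq_square by simp
  ultimately show ?thesis by linarith
qed

end

section \<open>Large conflict-free subfamilies\<close>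

definition indep :: "('x \<Rightarrow> 'x \<Rightarrow> bool) \<Rightarrow> 'x set \<Rightarrow> bool" where
  "indep conf F \<longleftrightarrow> (\<forall>x\<in>F. \<forall>y\<in>F. \<not> conf x y)"

text \<open>A maximum independent set is a fixed function of \<open>X\<close>, so the player can
  reconstruct it from the history, and it is at least as large as any independent set found inside a
  part of \<open>X\<close>.\<close>

definition max_indep :: "('x \<Rightarrow> 'x \<Rightarrow> bool) \<Rightarrow> 'x set \<Rightarrow> 'x set" where
  "max_indep conf X = (ARG_MAX card F. F \<subseteq> X \<and> indep conf F)"

lemma max_indep:
  assumes "finite X"
  shows "max_indep conf X \<subseteq> X" "indep conf (max_indep conf X)"
    "\<And>F. F \<subseteq> X \<Longrightarrow> indep conf F \<Longrightarrow> card F \<le> card (max_indep conf X)"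
proof -
  have 1: "{} \<subseteq> X \<and> indep conf {}" by (simp add: indep_def)
  have 2: "\<forall>F. F \<subseteq> X \<and> indep conf F \<longrightarrow> card F < Suc (card X)"
    using assms by (auto simp: less_Suc_eq_le card_mono)
  have "(max_indep conf X \<subseteq> X \<and> indep conf (max_indep conf X))"
    unfolding max_indep_def by (rule arg_max_natI[OF 1 2])
  then show "max_indep conf X \<subseteq> X" "indep conf (max_indep conf X)" by auto
  show "card F \<le> card (max_indep conf X)" if "F \<subseteq> X" "indep conf F" for F
    unfolding max_indep_def by (rule arg_max_nat_le[OF _ 2]) (use that in auto)
qed

text \<open>Take a maximum independent set inside the low-degree part \<open>G\<close>. Its closed
  neighbourhoods cover \<open>G\<close>, since an uncovered element could be added, and each has at
  most \<open>D + 1\<close> elements.\<close>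

lemma card_le_max_indep_degree:
  assumes "finite X" "G \<subseteq> X" "\<And>x y. conf x y \<Longrightarrow> conf y x" "\<And>x. \<not> conf x x"
    and "\<And>x. x \<in> G \<Longrightarrow> real (card {y \<in> X. conf x y}) \<le> D" and D: "D \<ge> 0"
  shows "real (card G) \<le> (D + 1) * real (card (max_indep conf X))"
proof -
  have fG: "finite G" using assms finite_subset by blast
  let ?F = "max_indep conf G"
  note F = max_indep[OF fG, where conf = conf]
  have fF: "finite ?F" using F(1) fG finite_subset by blast
  have "G \<subseteq> (\<Union>x\<in>?F. insert x {y \<in> X. conf x y})"
  proof
    fix z assume z: "z \<in> G"
    show "z \<in> (\<Union>x\<in>?F. insert x {y \<in> X. conf x y})"
    proof (rule ccontr)
      assume n: "z \<notin> (\<Union>x\<in>?F. insert x {y \<in> X. conf x y})"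
      then have "z \<notin> ?F" "\<And>x. x \<in> ?F \<Longrightarrow> \<not> conf x z" using z assms(2) by auto
      then have "indep conf (insert z ?F)"
        using F(2) assms(3,4) by (auto simp: indep_def)
      then have "card (insert z ?F) \<le> card ?F" using F z by (intro F(3)) auto
      then show False using fF \<open>z \<notin> ?F\<close> by simp
    qed
  qed
  then have "card G \<le> card (\<Union>x\<in>?F. insert x {y \<in> X. conf x y})"
    using fF assms(1) by (intro card_mono) auto
  also have "\<dots> \<le> (\<Sum>x\<in>?F. card (insert x {y \<in> X. conf x y}))" by (rule card_UN_le[OF fF])
  finally have "real (card G) \<le> (\<Sum>x\<in>?F. real (card (insert x {y \<in> X. conf x y})))"
    by (metis of_nat_le_iff of_nat_sum)
  also have "\<dots> \<le> (\<Sum>x\<in>?F. D + 1)"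
  proof (rule sum_mono)
    fix x assume "x \<in> ?F"
    then have "x \<in> G" using F(1) by auto
    have "card (insert x {y \<in> X. conf x y}) \<le> Suc (card {y \<in> X. conf x y})"
      by (rule card_insert_le_m1) auto
    then show "real (card (insert x {y \<in> X. conf x y})) \<le> D + 1"
      using assms(5)[OF \<open>x \<in> G\<close>] by linarith
  qed
  also have "\<dots> = (D + 1) * real (card ?F)" by simp
  also have "\<dots> \<le> (D + 1) * real (card (max_indep conf X))"
    using D F(1,2) assms(2) by (intro mult_left_mono) (auto intro!: max_indep(3)[OF assms(1)])
  finally show ?thesis .
qed

text \<open>Conflicts need to be few only on average: the elements of degree above \<open>D\<close>
  number at most the conflicting pairs divided by \<open>D\<close>, and the rest has bounded
  degree.\<close>

lemma card_le_max_indep: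
  assumes "finite X" "\<And>x y. conf x y \<Longrightarrow> conf y x" "\<And>x. \<not> conf x x" "D > 0"
  shows "real (card X) \<le> real (card {(x, y) \<in> X \<times> X. conf x y}) / D + (D + 1) * real (card (max_indep conf X))"
proof -
  let ?d = "\<lambda>x. real (card {y \<in> X. conf x y})"
  let ?G = "{x \<in> X. ?d x \<le> D}" and ?B = "{x \<in> X. ?d x > D}"
  have "{(x, y) \<in> X \<times> X. conf x y} = (SIGMA x:X. {y \<in> X. conf x y})" by auto
  then have "real (card {(x, y) \<in> X \<times> X. conf x y}) = (\<Sum>x\<in>X. ?d x)"
    using assms(1) by (simp add: card_SigmaI)
  also have "\<dots> \<ge> (\<Sum>x\<in>?B. ?d x)" using assms(1) by (intro sum_mono2) auto
  also have "(\<Sum>x\<in>?B. ?d x) \<ge> (\<Sum>x\<in>?B. D)" by (intro sum_mono) auto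
  finally have "real (card ?B) * D \<le> real (card {(x, y) \<in> X \<times> X. conf x y})" by simp
  then have "real (card ?B) \<le> real (card {(x, y) \<in> X \<times> X. conf x y}) / D"
    using assms(4) by (simp add: field_simps)
  moreover have "real (card ?G) \<le> (D + 1) * real (card (max_indep conf X))"
    using assms by (intro card_le_max_indep_degree) auto
  moreover have "card X = card (?G \<union> ?B)" by (intro arg_cong[of _ _ card]) auto
  then have "card X = card ?G + card ?B" using assms(1) by (subst (asm) card_Un_disjoint) auto
  ultimately show ?thesis by simp
qed

text \<open>One term for each way to fail: at most \<open>\<mu> / 2\<close> copies appear, more than
  \<open>D \<mu> / 4\<close> pairs of them conflict, or the family is missed in the second phase.
  Outside the first two events the family has at least \<open>\<mu> / (4 (D + 1))\<close> members.
  It depends on \<open>us\<close> only, so it is fixed while \<open>vs\<close> is averaged.\<close>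

lemma two_phase_failure:
  fixes R :: "'b set" and P :: "'x set" and \<rho> \<rho>' :: "nat \<Rightarrow> 'x \<Rightarrow> 'b"
  assumes R: "finite R" "R \<noteq> {}" and P: "finite P"
    and \<rho>: "\<And>x i. x \<in> P \<Longrightarrow> i < l1 \<Longrightarrow> \<rho> i x \<in> R" and \<rho>': "\<And>x i. x \<in> P \<Longrightarrow> i < l2 \<Longrightarrow> \<rho>' i x \<in> R"
    and q: "hitp R T > 0" and D: "D > 0" and \<mu>: "\<mu> = real (card P) * hitp R T ^ l1" "\<mu> > 0"
    and conf: "\<And>x y. conf x y \<longleftrightarrow> x \<noteq> y \<and> (\<exists>j<l2. \<rho>' j x = \<rho>' j y)"
    and v: "(\<Sum>I\<in>Pow {..<l1}. hitp R T ^ (2 * l1 - card I) * real (card {(x, y) \<in> P \<times> P. \<forall>i\<in>I. \<rho> i x = \<rho> i y}))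
       \<le> \<mu>\<^sup>2 + v"
    and z: "(\<Sum>I\<in>Pow {..<l1}. hitp R T ^ (2 * l1 - card I) *
         real (card {(x, y) \<in> P \<times> P. conf x y \<and> (\<forall>i\<in>I. \<rho> i x = \<rho> i y)})) \<le> z"
  defines "Pres \<equiv> \<lambda>us. {x \<in> P. hits l1 T (\<lambda>i. \<rho> i x) us}"
  shows "avg R (l1 * T) (\<lambda>us. avg R (l2 * T) (\<lambda>vs. of_bool (\<forall>x\<in>max_indep conf (Pres us). \<not> hits l2 T (\<lambda>i. \<rho>' i x) vs)))
    \<le> 4 * v / \<mu>\<^sup>2 + 4 * z / (D * \<mu>) + 16 * (D + 1) / (\<mu> * hitp R T ^ l2)"
proof -
  let ?q = "hitp R T"
  let ?X = "\<lambda>us. real (card (Pres us))"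
  let ?Z = "\<lambda>us. real (card {(x, y) \<in> Pres us \<times> Pres us. conf x y})"
  let ?c = "16 * (D + 1) / (\<mu> * ?q ^ l2)"
  have Zeq: "{(x, y) \<in> Pres us \<times> Pres us. conf x y}
      = {(x, y) \<in> {(x, y) \<in> P \<times> P. conf x y}. hits l1 T (\<lambda>i. \<rho> i x) us \<and> hits l1 T (\<lambda>i. \<rho> i y) us}" for us
    by (auto simp: Pres_def)
  have fconf: "finite {(x, y) \<in> P \<times> P. conf x y}"
    by (rule finite_subset[of _ "P \<times> P"]) (use P in auto)
  have X1: "avg R (l1 * T) ?X = \<mu>"
    unfolding Pres_def \<mu> using P \<rho> by (intro avg_card_hits R) auto
  have "avg R (l1 * T) (\<lambda>us. (?X us)\<^sup>2) \<le> \<mu>\<^sup>2 + v"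
    unfolding Pres_def card_hits_square[OF R P]
    by (rule order_trans[OF avg_pairs_le[OF R] v]) (use P \<rho> in auto)
  then have Xs: "avg R (l1 * T) (\<lambda>us. of_bool (?X us \<le> \<mu> / 2)) \<le> 4 * v / \<mu>\<^sup>2"
    by (intro chebyshev_half R \<mu> X1)
  have "avg R (l1 * T) ?Z \<le> z"
  proof -
    have "{(x, y) \<in> {(x, y) \<in> P \<times> P. conf x y}. \<forall>i\<in>I. \<rho> i x = \<rho> i y}
        = {(x, y) \<in> P \<times> P. conf x y \<and> (\<forall>i\<in>I. \<rho> i x = \<rho> i y)}" for I by auto
    then show ?thesis
      using avg_pairs_le[OF R fconf, of l1 \<rho> T] \<rho> z unfolding Zeq by fastforce
  qed
  then have "avg R (l1 * T) ?Z / (D * \<mu> / 4) \<le> z / (D * \<mu> / 4)"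
    using D \<mu>(2) by (intro divide_right_mono) auto
  moreover have "avg R (l1 * T) (\<lambda>us. of_bool (?Z us > D * \<mu> / 4)) \<le> avg R (l1 * T) ?Z / (D * \<mu> / 4)"
    using D \<mu>(2) by (intro markov R) auto
  ultimately have Zs: "avg R (l1 * T) (\<lambda>us. of_bool (?Z us > D * \<mu> / 4)) \<le> 4 * z / (D * \<mu>)"
    by (simp add: mult.commute)
  have inner: "avg R (l2 * T) (\<lambda>vs. of_bool (\<forall>x\<in>max_indep conf (Pres us). \<not> hits l2 T (\<lambda>i. \<rho>' i x) vs))
      \<le> of_bool (?X us \<le> \<mu> / 2) + of_bool (?Z us > D * \<mu> / 4) + ?c" (is "?I \<le> _") for us
  proof (cases "?X us \<le> \<mu> / 2 \<or> ?Z us > D * \<mu> / 4")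
    case True
    have "?I \<le> avg R (l2 * T) (\<lambda>_. 1)" by (intro avg_mono) auto
    then have "?I \<le> 1" by (simp add: avg_const R)
    moreover have "?c \<ge> 0" using D \<mu>(2) q by simp
    moreover have "(1::real) \<le> of_bool (?X us \<le> \<mu> / 2) + of_bool (?Z us > D * \<mu> / 4)"
      using True by (auto simp: of_bool_def)
    ultimately show ?thesis by linarith
  next
    case False
    let ?F = "max_indep conf (Pres us)"
    have fP: "finite (Pres us)" using P by (simp add: Pres_def)
    note F = max_indep[OF fP, where conf = conf]
    have fF: "finite ?F" using F(1) fP finite_subset by blast
    have FP: "?F \<subseteq> P" using F(1) by (auto simp: Pres_def)
    have "?X us \<le> ?Z us / D + (D + 1) * real (card ?F)"
      using fP D conf by (intro card_le_max_indep) auto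
    moreover have "?Z us / D \<le> \<mu> / 4" using False D by (simp add: field_simps)
    ultimately have N: "\<mu> / 4 \<le> (D + 1) * real (card ?F)" using False by linarith
    then have Npos: "real (card ?F) > 0" using \<mu>(2) D
      by (metis add_pos_pos divide_pos_pos less_le_trans mult_zero_right not_less of_nat_0_less_iff of_nat_0 gr0I zero_less_numeral)
    then have "?F \<noteq> {}" by auto
    moreover have "inj_on (\<rho>' i) ?F" if "i < l2" for i
      using F(2) that by (auto simp: inj_on_def indep_def conf)
    ultimately have "?I \<le> 4 / (real (card ?F) * ?q ^ l2)"
      using FP \<rho>' q by (intro avg_no_hit_disjoint R fF) auto
    also have "\<dots> \<le> 4 / (\<mu> / (4 * (D + 1)) * ?q ^ l2)"
      using N Npos D \<mu>(2) q by (intro divide_left_mono mult_right_mono) (auto simp: field_simps)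
    also have "\<dots> = ?c" using D \<mu>(2) by (simp add: field_simps)
    finally show ?thesis by simp
  qed
  have "avg R (l1 * T) (\<lambda>us. avg R (l2 * T) (\<lambda>vs. of_bool (\<forall>x\<in>max_indep conf (Pres us). \<not> hits l2 T (\<lambda>i. \<rho>' i x) vs)))
    \<le> avg R (l1 * T) (\<lambda>us. of_bool (?X us \<le> \<mu> / 2) + of_bool (?Z us > D * \<mu> / 4) + ?c)"
    by (intro avg_mono inner)
  also have "\<dots> \<le> 4 * v / \<mu>\<^sup>2 + 4 * z / (D * \<mu>) + ?c"
    unfolding avg_plus using Xs Zs by (simp add: avg_const R)
  finally show ?thesis .
qed

text \<open>Such a pair is determined by \<open>x\<close> and the values of \<open>y\<close> off
  \<open>W\<close>.\<close>

lemma card_agreeing_pairs: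
  assumes "finite A" "W \<subseteq> A" "finite B"
  shows "card {(x, y) \<in> (A \<rightarrow>\<^sub>E B) \<times> (A \<rightarrow>\<^sub>E B). \<forall>v\<in>W. x v = y v} \<le> card B ^ (2 * card A - card W)"
proof -
  let ?S = "{(x, y) \<in> (A \<rightarrow>\<^sub>E B) \<times> (A \<rightarrow>\<^sub>E B). \<forall>v\<in>W. x v = y v}"
  let ?f = "\<lambda>(x, y). (x, restrict y (A - W))"
  have "inj_on ?f ?S"
  proof (rule inj_onI)
    fix p p' assume p: "p \<in> ?S" "p' \<in> ?S" "?f p = ?f p'"
    obtain x y x' y' where xy: "p = (x, y)" "p' = (x', y')" by (cases p, cases p')
    have a: "x' = x" "y \<in> A \<rightarrow>\<^sub>E B" "y' \<in> A \<rightarrow>\<^sub>E B" "\<forall>v\<in>W. x v = y v" "\<forall>v\<in>W. x v = y' v"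
      "restrict y (A - W) = restrict y' (A - W)"
      using p by (auto simp: xy)
    have "y = y'"
    proof (rule PiE_ext[OF a(2,3)])
      fix v assume "v \<in> A"
      show "y v = y' v"
      proof (cases "v \<in> W")
        case False
        then show ?thesis using fun_cong[OF a(6), of v] \<open>v \<in> A\<close> by simp
      qed (use a in auto)
    qed
    then show "p = p'" using a(1) xy by simp
  qed
  moreover have "?f ` ?S \<subseteq> (A \<rightarrow>\<^sub>E B) \<times> ((A - W) \<rightarrow>\<^sub>E B)" by auto
  ultimately have "card ?S \<le> card ((A \<rightarrow>\<^sub>E B) \<times> ((A - W) \<rightarrow>\<^sub>E B))"
    using assms by (intro card_inj_on_le[of ?f]) (auto intro!: finite_PiE)
  also have "\<dots> = card B ^ (card A + card (A - W))"
    using assms by (simp add: card_cartesian_product card_PiE power_add)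
  also have "card A + card (A - W) = 2 * card A - card W"
    using assms by (simp add: card_Diff_subset finite_subset card_mono)
  finally show ?thesis .
qed

subsection \<open>Overlap weights\<close>

text \<open>In the plane of points \<open>(v, c)\<close> the balance hypothesis puts the point on or
  below the line through \<open>(r, 1)\<close> and \<open>(m, l1)\<close>; the claim does so for the
  line through the origin and \<open>(m, l1)\<close>. The lines meet at \<open>v = m\<close>, and
  \<open>m <= r * l1\<close> says that the second is at least as high at \<open>v = r\<close>, hence
  for all \<open>v <= m\<close>.\<close>

lemma balanced_exponent_le:
  fixes m r l1 v c :: real
  assumes "0 \<le> r" "r < m" "0 \<le> l1" "v \<le> m" "m \<le> r * l1" "(c - 1) * (m - r) \<le> (l1 - 1) * (v - r)"
  shows "m * c \<le> l1 * v"
proof -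
  have "m * ((c - 1) * (m - r)) \<le> m * ((l1 - 1) * (v - r))"
    using assms by (intro mult_left_mono) auto
  moreover have "0 \<le> (m - v) * (r * l1 - m)" using assms by (intro mult_nonneg_nonneg) auto
  ultimately have "m * c * (m - r) \<le> l1 * v * (m - r)" by (simp add: algebra_simps)
  then show ?thesis using assms(2) by simp
qed

context
  fixes m r l1 l2 :: nat and \<theta> N q y :: real
  assumes mr: "r < m" and l1: "2 \<le> l1" and cover: "m \<le> r * l1"
    and dens: "real (l1 + l2) * (real m - real r) \<le> real m * (real l1 - 1)"
    and \<theta>: "\<theta> = real m / real (l1 + l2)"
    and N: "1 \<le> N" and q: "0 < q" "q \<le> 1" and y: "y = q * N powr \<theta>" "1 \<le> y"
begin

text \<open>Trades \<open>q\<close> for \<open>y\<close>: afterwards the sign of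
  \<open>v - \<theta> * c\<close> decides whether a weight can grow with \<open>N\<close>, and
  \<open>c = l1 + l2\<close>, \<open>v = m\<close> gives a pure power of \<open>y\<close>.\<close>

lemma powr_form: "q ^ c * N ^ v = y ^ c * N powr (real v - \<theta> * real c)"
proof -
  have "(N powr \<theta>) ^ c = N powr (\<theta> * real c)" using N by (subst powr_power) (auto simp: mult.commute)
  then have "y ^ c * N powr (real v - \<theta> * real c) = q ^ c * (N powr (\<theta> * real c) * N powr (real v - \<theta> * real c))"
    by (simp add: y(1) power_mult_distrib)
  also have "\<dots> = q ^ c * N ^ v" using N by (simp flip: powr_add add: powr_realpow)
  finally show ?thesis ..
qed

text \<open>The weight \<open>q^c * N^v\<close> is the expected number of copies of a subflower with
  \<open>c\<close> edges and \<open>v\<close> vertices. Pairs of copies sharing such a part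
  contribute at most \<open>\<mu>^2\<close> divided by it to the second moment, so it must be large;
  edge-balancedness ensures this.\<close>

lemma overlap_weight_ge:
  assumes "1 \<le> c" "v \<le> m" "(real c - 1) * (real m - real r) \<le> (real l1 - 1) * (real v - real r)"
  shows "y \<le> q ^ c * N ^ v"
proof -
  have cov: "real m \<le> real r * real l1" using cover by (metis of_nat_le_iff of_nat_mult)
  have "real m * real c \<le> real l1 * real v"
    by (rule balanced_exponent_le[OF _ _ _ _ cov assms(3)]) (use mr assms(2) in simp_all)
  also have "\<dots> \<le> real (l1 + l2) * real v" by (intro mult_right_mono) auto
  finally have h: "real m * real c \<le> real v * real (l1 + l2)" by (simp only: mult.commute)
  have "real m * real c / real (l1 + l2) \<le> real v"
    using h l1 by (intro mult_imp_div_pos_le) auto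
  then have "\<theta> * real c \<le> real v" by (simp add: \<theta>)
  then have "1 \<le> N powr (real v - \<theta> * real c)" using N by (intro ge_one_powr_ge_zero) auto
  moreover have "y \<le> y ^ c" using assms(1) y(2) by (intro self_le_power) auto
  ultimately have "y * 1 \<le> y ^ c * N powr (real v - \<theta> * real c)"
    using y(2) by (intro mult_mono) auto
  then show ?thesis by (simp add: powr_form)
qed

text \<open>The counterpart for conflicting pairs: \<open>w\<close> counts the vertices shared
  through common rays together with the \<open>r\<close> vertices of a common cap role. With
  \<open>\<mu> = N^m * q^l1\<close> the claim is
  \<open>\<mu>^2 / (q^c * N^w) <= \<mu> * y^(l1 - 1)\<close>, so on average a present copy has
  \<open>O(y^(l1 - 1))\<close> conflicts.\<close>

lemma conflict_weight_ge:
  assumes "c \<le> l1" "v \<le> w" "r \<le> w" "v \<le> m"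
    "c \<ge> 1 \<Longrightarrow> (real c - 1) * (real m - real r) \<le> (real l1 - 1) * (real v - real r)"
  shows "N ^ m * q ^ l1 \<le> q ^ c * N ^ w * y ^ (l1 - 1)"
proof -
  \<comment> \<open>The density hypothesis in this notation: fixing \<open>r\<close> vertices and
    asking for \<open>l1 - 1\<close> hits leaves no positive power of \<open>N\<close>.\<close>
  have th: "real m - real r \<le> \<theta> * (real l1 - 1)"
    unfolding \<theta> using dens l1 by (simp add: field_simps)
  show ?thesis
  proof (cases "c = 0")
    case True
    \<comment> \<open>One factor \<open>q\<close> is given away, because the target allows only
      \<open>y^(l1 - 1)\<close> and the density hypothesis speaks of \<open>l1 - 1\<close>
      hits.\<close>
    have "N ^ m * q ^ l1 \<le> N ^ m * q ^ (l1 - 1)"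
      using N q by (intro mult_left_mono power_decreasing) auto
    also have "\<dots> = y ^ (l1 - 1) * N powr (real m - \<theta> * real (l1 - 1))"
      using powr_form[of "l1 - 1" m] by (simp add: mult.commute)
    also have "\<dots> \<le> y ^ (l1 - 1) * N powr real w"
      using th l1 N y(2) assms(3) by (intro mult_left_mono powr_mono) (auto simp: of_nat_diff)
    also have "\<dots> = q ^ c * N ^ w * y ^ (l1 - 1)" using True N by (simp add: powr_realpow)
    finally show ?thesis .
  next
    case False
    then have b: "(real c - 1) * (real m - real r) \<le> (real l1 - 1) * (real v - real r)"
      by (intro assms(5)) simp
    \<comment> \<open>Balance compares the \<open>m - v\<close> vertices outside the shared part
      with the \<open>l1 - c\<close> rays outside it, at the rate \<open>(m - r) / (l1 - 1)\<close>;
      by the density hypothesis this rate is at most \<open>\<theta>\<close>.\<close>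
    have "(real m - real v) * (real m - real r) \<le> \<theta> * (real l1 - real c) * (real m - real r)"
    proof -
      have "(real m - real v) * (real m - real r) \<le> (real m - real v) * (\<theta> * (real l1 - 1))"
        using th assms(4) by (intro mult_left_mono) auto
      also have "\<dots> = \<theta> * ((real l1 - 1) * (real m - real v))" by simp
      also have "\<dots> \<le> \<theta> * ((real l1 - real c) * (real m - real r))"
      proof (rule mult_left_mono)
        show "(real l1 - 1) * (real m - real v) \<le> (real l1 - real c) * (real m - real r)"
          using b by (simp add: algebra_simps)
      qed (simp add: \<theta>)
      finally show ?thesis by (simp add: mult.assoc)
    qed
    then have e: "real m - real v \<le> \<theta> * (real l1 - real c)" using mr by simp
    have "N ^ m * q ^ l1 = y ^ l1 * N powr (real m - \<theta> * real l1)"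
      using powr_form[of l1 m] by (simp add: mult.commute)
    \<comment> \<open>Since \<open>c >= 1\<close>, the surplus factor of \<open>y^l1\<close> over
      \<open>y^(l1 - 1)\<close> is absorbed by \<open>y^c\<close>.\<close>
    also have "\<dots> \<le> y ^ (c + (l1 - 1)) * N powr (real w - \<theta> * real c)"
    proof (intro mult_mono power_increasing powr_mono)
      show "real m - \<theta> * real l1 \<le> real w - \<theta> * real c" using e assms(2) by (simp add: algebra_simps)
    qed (use False N y(2) in auto)
    also have "\<dots> = q ^ c * N ^ w * y ^ (l1 - 1)" using powr_form[of c w] by (simp add: power_add mult_ac)
    finally show ?thesis .
  qed
qed

end

text \<open>Roles are kept abstract: the counting uses only which coordinates two placements must
  share when a role coincides, \<open>Q i\<close> for rays and \<open>S j\<close> for caps.\<close>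

lemma block_failure:
  fixes A :: "'a set" and R :: "'b set" and \<rho> \<rho>' :: "nat \<Rightarrow> ('a \<Rightarrow> nat) \<Rightarrow> 'b" and Q S :: "nat \<Rightarrow> 'a set"
  assumes A: "finite A" "card A = m" and R: "finite R" "R \<noteq> {}" and N: "n0 \<ge> 1"
  defines "P \<equiv> A \<rightarrow>\<^sub>E {..<n0}"
  assumes \<rho>: "\<And>x i. x \<in> P \<Longrightarrow> i < l1 \<Longrightarrow> \<rho> i x \<in> R" and \<rho>': "\<And>x i. x \<in> P \<Longrightarrow> i < l2 \<Longrightarrow> \<rho>' i x \<in> R"
    and Q: "\<And>x y i. x \<in> P \<Longrightarrow> y \<in> P \<Longrightarrow> i < l1 \<Longrightarrow> \<rho> i x = \<rho> i y \<Longrightarrow> \<forall>v\<in>Q i. x v = y v"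
    and S: "\<And>x y i. x \<in> P \<Longrightarrow> y \<in> P \<Longrightarrow> i < l2 \<Longrightarrow> \<rho>' i x = \<rho>' i y \<Longrightarrow> \<forall>v\<in>S i. x v = y v"
    and QA: "\<And>i. i < l1 \<Longrightarrow> Q i \<subseteq> A" and SA: "\<And>i. i < l2 \<Longrightarrow> S i \<subseteq> A \<and> card (S i) = r"
    and mr: "r < m" and l1: "2 \<le> l1" and cover: "m \<le> r * l1"
    and dens: "real (l1 + l2) * (real m - real r) \<le> real m * (real l1 - 1)"
    and \<theta>: "\<theta> = real m / real (l1 + l2)"
    and bal: "\<And>I. I \<subseteq> {..<l1} \<Longrightarrow> I \<noteq> {} \<Longrightarrow>
        (real (card I) - 1) * (real m - real r) \<le> (real l1 - 1) * (real (card (\<Union> (Q ` I))) - real r)"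
    and y: "y = hitp R T * real n0 powr \<theta>" "1 \<le> y"
    and conf: "\<And>x y. conf x y \<longleftrightarrow> x \<noteq> y \<and> (\<exists>j<l2. \<rho>' j x = \<rho>' j y)"
  shows "avg R (l1 * T) (\<lambda>us. avg R (l2 * T) (\<lambda>vs. of_bool
           (\<forall>x\<in>max_indep conf {x \<in> P. hits l1 T (\<lambda>i. \<rho> i x) us}. \<not> hits l2 T (\<lambda>i. \<rho>' i x) vs)))
    \<le> (4 * 2 ^ l1 * (1 + real l2) + 32) / sqrt y"
proof -
  let ?N = "real n0" and ?q = "hitp R T"
  have q: "0 < ?q" "?q \<le> 1"
    using y hitp_bounds[OF R, of T] N by (auto simp: less_le)
  have N1: "1 \<le> ?N" using N by simp
  note ov = overlap_weight_ge[OF mr l1 cover dens \<theta> N1 q y]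
  note cw = conflict_weight_ge[OF mr l1 cover dens \<theta> N1 q y]
  note pf = powr_form[OF mr l1 cover dens \<theta> N1 q y]
  define \<mu> where "\<mu> = real (card P) * ?q ^ l1"
  have fP: "finite P" unfolding P_def using A by (intro finite_PiE) auto
  have cP: "real (card P) = ?N ^ m" unfolding P_def using A by (simp add: card_PiE)
  have \<mu>: "\<mu> > 0" "\<mu> = ?N ^ m * ?q ^ l1" using q N1 by (simp_all add: \<mu>_def cP)
  define V where "V I = \<Union> (Q ` I)" for I
  have VA: "V I \<subseteq> A" if "I \<subseteq> {..<l1}" for I using QA that by (auto simp: V_def)
  have Vm: "card (V I) \<le> m" if "I \<subseteq> {..<l1}" for I
    using card_mono[OF A(1) VA[OF that]] A(2) by simp
  have pair_weight: "?q ^ (2 * l1 - c) * real k \<le> \<mu>\<^sup>2 / (?q ^ c * ?N ^ w)"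
    if "c \<le> l1" "w \<le> m" "k \<le> n0 ^ (2 * m - w)" for c w k
  proof -
    have "?q ^ (2 * l1 - c) * real k \<le> ?q ^ (2 * l1 - c) * ?N ^ (2 * m - w)"
      using q that(3) by (intro mult_left_mono) (auto simp flip: of_nat_power)
    also have "\<dots> = ?q ^ (2 * l1) / ?q ^ c * (?N ^ (2 * m) / ?N ^ w)"
      using q N1 that by (simp add: power_diff)
    also have "\<dots> = \<mu>\<^sup>2 / (?q ^ c * ?N ^ w)"
      by (simp add: \<mu>(2) power_mult_distrib power_mult[symmetric] mult.commute)
    finally show ?thesis .
  qed
  have cI: "card I \<le> l1" if "I \<subseteq> {..<l1}" for I using card_mono[OF _ that] by simp
  have card_agree: "card {(x, y) \<in> P \<times> P. \<forall>i\<in>I. \<rho> i x = \<rho> i y} \<le> n0 ^ (2 * m - card (V I))"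
    if "I \<subseteq> {..<l1}" for I
  proof -
    have "card {(x, y) \<in> P \<times> P. \<forall>i\<in>I. \<rho> i x = \<rho> i y} \<le> card {(x, y) \<in> P \<times> P. \<forall>v\<in>V I. x v = y v}"
    proof (rule card_mono)
      show "finite {(x, y) \<in> P \<times> P. \<forall>v\<in>V I. x v = y v}"
        by (rule finite_subset[of _ "P \<times> P"]) (use fP in auto)
      show "{(x, y) \<in> P \<times> P. \<forall>i\<in>I. \<rho> i x = \<rho> i y} \<subseteq> {(x, y) \<in> P \<times> P. \<forall>v\<in>V I. x v = y v}"
        using Q that unfolding V_def by fastforce
    qed
    also have "\<dots> \<le> n0 ^ (2 * m - card (V I))"
      using card_agreeing_pairs[OF A(1) VA[OF that], of "{..<n0}"] A(2) by (simp add: P_def)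
    finally show ?thesis .
  qed
  have v: "(\<Sum>I\<in>Pow {..<l1}. ?q ^ (2 * l1 - card I) * real (card {(x, y) \<in> P \<times> P. \<forall>i\<in>I. \<rho> i x = \<rho> i y}))
       \<le> \<mu>\<^sup>2 + 2 ^ l1 * \<mu>\<^sup>2 / y"
  proof -
    have "(\<Sum>I\<in>Pow {..<l1}. ?q ^ (2 * l1 - card I) * real (card {(x, y) \<in> P \<times> P. \<forall>i\<in>I. \<rho> i x = \<rho> i y}))
      \<le> (\<Sum>I\<in>Pow {..<l1}. (if I = {} then \<mu>\<^sup>2 else 0) + \<mu>\<^sup>2 / y)"
    proof (rule sum_mono)
      fix I assume "I \<in> Pow {..<l1}"
      then have I: "I \<subseteq> {..<l1}" by simp
      have "?q ^ (2 * l1 - card I) * real (card {(x, y) \<in> P \<times> P. \<forall>i\<in>I. \<rho> i x = \<rho> i y})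
          \<le> \<mu>\<^sup>2 / (?q ^ card I * ?N ^ card (V I))"
        by (intro pair_weight card_agree cI Vm I)
      also have "\<dots> \<le> (if I = {} then \<mu>\<^sup>2 else 0) + \<mu>\<^sup>2 / y"
      proof (cases "I = {}")
        case True
        then show ?thesis using y(2) by (simp add: V_def)
      next
        case False
        have "finite I" using I finite_subset by blast
        then have "1 \<le> card I" using False by (simp add: Suc_le_eq card_gt_0_iff)
        then have "y \<le> ?q ^ card I * ?N ^ card (V I)"
          using bal[OF I False] Vm[OF I] by (intro ov) (auto simp: V_def)
        then show ?thesis using False y(2) by (auto intro!: divide_left_mono)
      qed
      finally show "?q ^ (2 * l1 - card I) * real (card {(x, y) \<in> P \<times> P. \<forall>i\<in>I. \<rho> i x = \<rho> i y})
          \<le> (if I = {} then \<mu>\<^sup>2 else 0) + \<mu>\<^sup>2 / y" .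
    qed
    also have "\<dots> = \<mu>\<^sup>2 + 2 ^ l1 * \<mu>\<^sup>2 / y"
      by (simp add: sum.distrib card_Pow sum.delta)
    finally show ?thesis .
  qed
  have z: "(\<Sum>I\<in>Pow {..<l1}. ?q ^ (2 * l1 - card I) *
         real (card {(x, y) \<in> P \<times> P. conf x y \<and> (\<forall>i\<in>I. \<rho> i x = \<rho> i y)})) \<le> 2 ^ l1 * (real l2 * (\<mu> * y ^ (l1 - 1)))"
  proof -
    have "(\<Sum>I\<in>Pow {..<l1}. ?q ^ (2 * l1 - card I) *
         real (card {(x, y) \<in> P \<times> P. conf x y \<and> (\<forall>i\<in>I. \<rho> i x = \<rho> i y)}))
      \<le> (\<Sum>I\<in>Pow {..<l1}. real l2 * (\<mu> * y ^ (l1 - 1)))"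
    proof (rule sum_mono)
      fix I assume "I \<in> Pow {..<l1}"
      then have I: "I \<subseteq> {..<l1}" by simp
      \<comment> \<open>A conflicting pair that agrees on \<open>I\<close> shares the coordinates of
        these rays and those of some \<open>S j\<close>, hence at least \<open>r\<close> coordinates
        even when \<open>I\<close> is empty.\<close>
      let ?W = "\<lambda>j. V I \<union> S j"
      let ?A = "\<lambda>j. {(x, y) \<in> P \<times> P. \<forall>v\<in>?W j. x v = y v}"
      have fA: "finite (?A j)" for j
        by (rule finite_subset[of _ "P \<times> P"]) (use fP in auto)
      have WA: "?W j \<subseteq> A" if "j < l2" for j using VA[OF I] SA[OF that] by auto
      have "{(x, y) \<in> P \<times> P. conf x y \<and> (\<forall>i\<in>I. \<rho> i x = \<rho> i y)} \<subseteq> (\<Union>j<l2. ?A j)"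
      proof clarify
        fix x y assume xy: "x \<in> P" "y \<in> P" "conf x y" "\<forall>i\<in>I. \<rho> i x = \<rho> i y"
        then obtain j where j: "j < l2" "\<rho>' j x = \<rho>' j y" unfolding conf by blast
        have "x v = y v" if vV: "v \<in> V I" for v
        proof -
          obtain i where "i \<in> I" "v \<in> Q i" using vV by (auto simp: V_def)
          then show ?thesis using Q[OF xy(1,2), of i] xy(4) I by auto
        qed
        moreover have "\<forall>v\<in>S j. x v = y v" by (rule S[OF xy(1,2) j])
        ultimately show "(x, y) \<in> (\<Union>j<l2. ?A j)" using xy j by auto
      qed
      then have "card {(x, y) \<in> P \<times> P. conf x y \<and> (\<forall>i\<in>I. \<rho> i x = \<rho> i y)} \<le> card (\<Union>j<l2. ?A j)"
        using fA by (intro card_mono) auto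
      also have "\<dots> \<le> (\<Sum>j<l2. card (?A j))" by (rule card_UN_le) simp
      finally have "card {(x, y) \<in> P \<times> P. conf x y \<and> (\<forall>i\<in>I. \<rho> i x = \<rho> i y)} \<le> (\<Sum>j<l2. card (?A j))" .
      from of_nat_mono[OF this, where 'a = real]
      have "real (card {(x, y) \<in> P \<times> P. conf x y \<and> (\<forall>i\<in>I. \<rho> i x = \<rho> i y)}) \<le> (\<Sum>j<l2. real (card (?A j)))"
        unfolding of_nat_sum .
      then have "?q ^ (2 * l1 - card I) * real (card {(x, y) \<in> P \<times> P. conf x y \<and> (\<forall>i\<in>I. \<rho> i x = \<rho> i y)})
         \<le> ?q ^ (2 * l1 - card I) * (\<Sum>j<l2. real (card (?A j)))"
        using q by (intro mult_left_mono) auto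
      also have "\<dots> = (\<Sum>j<l2. ?q ^ (2 * l1 - card I) * real (card (?A j)))"
        by (rule sum_distrib_left)
      also have "\<dots> \<le> (\<Sum>j<l2. \<mu> * y ^ (l1 - 1))"
      proof (rule sum_mono)
        fix j assume "j \<in> {..<l2}"
        then have j: "j < l2" by simp
        have fW: "finite (?W j)" using WA[OF j] A(1) finite_subset by blast
        have Wm: "card (?W j) \<le> m" using card_mono[OF A(1) WA[OF j]] A(2) by simp
        have "?q ^ (2 * l1 - card I) * real (card (?A j)) \<le> \<mu>\<^sup>2 / (?q ^ card I * ?N ^ card (?W j))"
          using card_agreeing_pairs[OF A(1) WA[OF j], of "{..<n0}"] A(2)
          by (intro pair_weight cI I Wm) (simp add: P_def)
        also have "\<dots> \<le> \<mu> * y ^ (l1 - 1)"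
        proof -
          have "r \<le> card (?W j)" using card_mono[OF fW, of "S j"] SA[OF j] by simp
          moreover have "card (V I) \<le> card (?W j)" using fW by (intro card_mono) auto
          moreover have "1 \<le> card I \<Longrightarrow> I \<noteq> {}" by auto
          ultimately have "\<mu> \<le> ?q ^ card I * ?N ^ card (?W j) * y ^ (l1 - 1)"
            unfolding \<mu>(2) using bal[OF I] Vm[OF I] cI[OF I]
            by (intro cw[where v = "card (V I)"]) (auto simp: V_def)
          then have "\<mu> * \<mu> \<le> \<mu> * (?q ^ card I * ?N ^ card (?W j) * y ^ (l1 - 1))"
            using \<mu>(1) by (intro mult_left_mono) auto
          then show ?thesis using q N1 by (simp add: divide_le_eq power2_eq_square mult_ac)
        qed
        finally show "?q ^ (2 * l1 - card I) * real (card (?A j)) \<le> \<mu> * y ^ (l1 - 1)" .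
      qed
      also have "\<dots> = real l2 * (\<mu> * y ^ (l1 - 1))" by simp
      finally show "?q ^ (2 * l1 - card I) * real (card {(x, y) \<in> P \<times> P. conf x y \<and> (\<forall>i\<in>I. \<rho> i x = \<rho> i y)})
        \<le> real l2 * (\<mu> * y ^ (l1 - 1))" .
    qed
    then show ?thesis by (simp add: card_Pow)
  qed
  \<comment> \<open>A factor \<open>sqrt y\<close> above the average conflict bound
    \<open>y^(l1 - 1)\<close> makes the conflict term of order \<open>1 / sqrt y\<close>, while
    \<open>D * sqrt y = y^l1 <= y^(l1 + l2)\<close> keeps the hitting term at the same
    order.\<close>
  define D where "D = sqrt y * y ^ (l1 - 1)"
  have sy: "1 \<le> sqrt y" "sqrt y * sqrt y = y" using y(2) by auto
  have D1: "1 \<le> D" unfolding D_def using sy y(2) mult_mono[of 1 "sqrt y" 1 "y ^ (l1 - 1)"] by simp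
  have "avg R (l1 * T) (\<lambda>us. avg R (l2 * T) (\<lambda>vs. of_bool
           (\<forall>x\<in>max_indep conf {x \<in> P. hits l1 T (\<lambda>i. \<rho> i x) us}. \<not> hits l2 T (\<lambda>i. \<rho>' i x) vs)))
    \<le> 4 * (2 ^ l1 * \<mu>\<^sup>2 / y) / \<mu>\<^sup>2 + 4 * (2 ^ l1 * (real l2 * (\<mu> * y ^ (l1 - 1)))) / (D * \<mu>)
       + 16 * (D + 1) / (\<mu> * ?q ^ l2)"
    using D1 \<mu>(1) by (intro two_phase_failure R fP \<rho> \<rho>' q(1) \<mu>_def conf v z) auto
  also have "\<dots> \<le> 4 * 2 ^ l1 / sqrt y + 4 * 2 ^ l1 * real l2 / sqrt y + 32 / sqrt y"
  proof -
    have "sqrt y * 1 \<le> sqrt y * sqrt y" using sy(1) by (intro mult_left_mono) auto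
    then have "1 / y \<le> 1 / sqrt y" using sy y(2) by (intro divide_left_mono) auto
    then have "4 * 2 ^ l1 * (1 / y) \<le> 4 * 2 ^ l1 * (1 / sqrt y)" by (intro mult_left_mono) auto
    then have 1: "4 * (2 ^ l1 * \<mu>\<^sup>2 / y) / \<mu>\<^sup>2 \<le> 4 * 2 ^ l1 / sqrt y" using \<mu>(1) by simp
    define k where "k = \<mu> * y ^ (l1 - 1)"
    have k: "k > 0" unfolding k_def using \<mu>(1) y(2) by simp
    have Dk: "D * \<mu> = sqrt y * k" by (simp add: D_def k_def)
    have 2: "4 * (2 ^ l1 * (real l2 * k)) / (D * \<mu>) \<le> 4 * 2 ^ l1 * real l2 / sqrt y"
      unfolding Dk using k by simp
    have "\<mu> * ?q ^ l2 = ?q ^ (l1 + l2) * ?N ^ m" by (simp add: \<mu>(2) power_add)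
    also have "\<dots> = y ^ (l1 + l2) * ?N powr (real m - \<theta> * real (l1 + l2))" by (rule pf)
    also have "real m - \<theta> * real (l1 + l2) = 0" using l1 by (simp add: \<theta>)
    finally have e: "\<mu> * ?q ^ l2 = y ^ (l1 + l2)" using N1 by simp
    have "D * sqrt y = y ^ (l1 - 1) * (sqrt y * sqrt y)" by (simp add: D_def)
    also have "\<dots> = y ^ Suc (l1 - 1)" by (simp only: sy(2) power_Suc2)
    also have "Suc (l1 - 1) = l1" using l1 by simp
    also have "y ^ l1 \<le> y ^ (l1 + l2)" using y(2) by (intro power_increasing) auto
    finally have Dy: "D * sqrt y \<le> y ^ (l1 + l2)" .
    have "(D + 1) * sqrt y \<le> (2 * D) * sqrt y" using D1 sy(1) by (intro mult_right_mono) auto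
    then have "16 * (D + 1) * sqrt y \<le> 32 * y ^ (l1 + l2)" using Dy by linarith
    moreover have "y ^ (l1 + l2) > 0" using y(2) by simp
    ultimately have 3: "16 * (D + 1) / (\<mu> * ?q ^ l2) \<le> 32 / sqrt y"
      unfolding e using sy(1) by (intro mult_imp_div_pos_le) (auto simp: field_simps)
    show ?thesis using 1 2 3 unfolding k_def by linarith
  qed
  also have "\<dots> = (4 * 2 ^ l1 * (1 + real l2) + 32) / sqrt y"
    by (simp add: add_divide_distrib algebra_simps)
  finally show ?thesis .
qed

subsection \<open>The strategy\<close>

text \<open>\<open>S j\<close> is the part of the \<open>j\<close>-th cap edge reserved for the
  random set; the player adds the rest. It avoids \<open>C\<close> because all copies share the
  image of the center, so only vertices outside it tell two copies apart.\<close>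

locale starplus_play =
  fixes V C :: "'a set" and r s k l1 l2 :: nat and idx :: "'a \<Rightarrow> nat"
    and ray cap S :: "nat \<Rightarrow> 'a set"
  assumes finV: "finite V" and CV: "C \<subseteq> V" and cardC: "card C = s - r" and rs: "r < s"
    and idx: "inj_on idx V" "\<And>v. v \<in> V \<Longrightarrow> idx v < k"
    and ray: "\<And>i. i < l1 \<Longrightarrow> C \<subseteq> ray i \<and> ray i \<subseteq> V \<and> card (ray i) = s"
    and cap: "\<And>j. j < l2 \<Longrightarrow> cap j \<subseteq> V \<and> card (cap j) = s"
    and S: "\<And>j. j < l2 \<Longrightarrow> S j \<subseteq> cap j - C \<and> card (S j) = r"
    and l1: "2 \<le> l1"
begin

text \<open>Each vertex of \<open>H\<close> gets its own interval of \<open>n div k\<close> vertices of \<open>[n]\<close>. This makes every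
  coordinate function \<open>x\<close> injective, and two embeddings have the same image of a vertex set only if
  they agree on it pointwise.\<close>
definition emb :: "nat \<Rightarrow> ('a \<Rightarrow> nat) \<Rightarrow> 'a \<Rightarrow> nat" where
  "emb n x v = idx v * (n div k) + (if v \<in> C then 0 else x v)"

definition embs :: "nat \<Rightarrow> ('a \<Rightarrow> nat) set" where
  "embs n = (V - C) \<rightarrow>\<^sub>E {..<n div k}"

definition ray_role :: "nat \<Rightarrow> nat \<Rightarrow> ('a \<Rightarrow> nat) \<Rightarrow> nat set" where
  "ray_role n i x = emb n x ` (ray i - C)"

definition cap_role :: "nat \<Rightarrow> nat \<Rightarrow> ('a \<Rightarrow> nat) \<Rightarrow> nat set" where
  "cap_role n j x = emb n x ` S j"

definition conf :: "nat \<Rightarrow> ('a \<Rightarrow> nat) \<Rightarrow> ('a \<Rightarrow> nat) \<Rightarrow> bool" where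
  "conf n x y \<longleftrightarrow> x \<noteq> y \<and> (\<exists>j<l2. cap_role n j x = cap_role n j y)"

definition family :: "nat \<Rightarrow> nat \<Rightarrow> nat set list \<Rightarrow> ('a \<Rightarrow> nat) set" where
  "family n T us = max_indep (conf n) {x \<in> embs n. hits l1 T (\<lambda>i. ray_role n i x) us}"

text \<open>Steps \<open>L T, \<dots>, 2 L T - 1\<close> with \<open>T\<close> a power of two and \<open>L = l1 + l2\<close> form one round, which does
  not use earlier edges. The round splits into \<open>L\<close> blocks of length \<open>T\<close>, and block \<open>i\<close> serves the
  \<open>i\<close>-th edge of \<open>H\<close>.\<close>
definition round_len :: "nat \<Rightarrow> nat" where
  "round_len j = 2 ^ floor_log (j div (l1 + l2))"

text \<open>Round, block and the sets \<open>us\<close> of the ray blocks are read off the history.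
  In the cap blocks \<open>us\<close> is complete, so the family stays the same for the rest of the
  round. On the center \<open>emb\<close> ignores its argument, hence the arbitrary
  \<open>\<lambda>_. 0\<close>. In the steps before the first round \<open>T = 1\<close>, and
  truncated subtraction gives \<open>i = 0\<close>.\<close>

definition response :: "nat \<Rightarrow> (nat set \<times> nat set) list \<Rightarrow> nat set \<Rightarrow> nat set" where
  "response n h U =
    (let j = length h; T = round_len j; i = (j - (l1 + l2) * T) div T;
         us = take (l1 * T) (drop ((l1 + l2) * T) (map fst h))
     in if i < l1 then emb n (\<lambda>_. 0) ` C
        else emb n (SOME x. x \<in> family n T us \<and> cap_role n (i - l1) x = U) ` (cap (i - l1) - S (i - l1)))"

text \<open>The fallback covers steps where the plan is not a legal move, for instance when
  \<open>U\<close> meets the image of the center in a ray block.\<close>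

definition strat :: strategy where
  "strat n h U =
    (if response n h U \<subseteq> {..<n} - U \<and> card (response n h U) = s - r then response n h U
     else (SOME W. W \<subseteq> {..<n} - U \<and> card W = s - r))"

lemma valid_strat: "valid_strategy r s strat"
  unfolding valid_strategy_def
proof (intro allI impI)
  fix n and h :: "(nat set \<times> nat set) list" and U assume n: "s \<le> n" and U: "U \<in> rsets n r"
  have "finite U" using U finite_subset by (auto simp: rsets_def)
  then have "card ({..<n} - U) = n - r" using U by (simp add: rsets_def card_Diff_subset)
  then have "s - r \<le> card ({..<n} - U)" using n by simp
  then obtain W where "W \<subseteq> {..<n} - U" "card W = s - r" using obtain_subset_with_card_n by metis
  then have "\<exists>W. W \<subseteq> {..<n} - U \<and> card W = s - r" by blast
  from someI_ex[OF this] show "strat n h U \<subseteq> {..<n} - U \<and> card (strat n h U) = s - r"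
    by (simp add: strat_def)
qed

lemma emb_lt:
  assumes "x \<in> embs n" "v \<in> V" "1 \<le> n div k"
  shows "emb n x v < n" "emb n x v div (n div k) = idx v"
    "emb n x v mod (n div k) = (if v \<in> C then 0 else x v)"
proof -
  let ?b = "if v \<in> C then 0 else x v"
  have b: "?b < n div k" using assms by (auto simp: embs_def PiE_iff)
  have "Suc (idx v) * (n div k) \<le> k * (n div k)" using idx(2)[OF assms(2)] by (intro mult_right_mono) auto
  also have "\<dots> \<le> n" by simp
  finally show "emb n x v < n" using b by (simp add: emb_def)
  show "emb n x v div (n div k) = idx v" "emb n x v mod (n div k) = ?b"
    using b by (simp_all add: emb_def)
qed

lemma inj_emb:
  assumes "x \<in> embs n" "1 \<le> n div k"
  shows "inj_on (emb n x) V"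
  using emb_lt(2)[OF assms(1) _ assms(2)] idx(1) by (metis inj_on_def)

lemma emb_image_eq:
  assumes "x \<in> embs n" "y \<in> embs n" "1 \<le> n div k" "W \<subseteq> V - C" "emb n x ` W = emb n y ` W"
  shows "\<forall>v\<in>W. x v = y v"
proof
  fix v assume v: "v \<in> W"
  then obtain w where w: "w \<in> W" "emb n x v = emb n y w" using assms(5) by blast
  have V: "v \<in> V" "w \<in> V" "v \<notin> C" "w \<notin> C" using v w assms(4) by auto
  have "idx v = idx w"
    using emb_lt(2)[OF assms(1) V(1) assms(3)] emb_lt(2)[OF assms(2) V(2) assms(3)] w(2) by simp
  then have "v = w" using idx(1) V by (auto dest: inj_onD)
  then show "x v = y v"
    using emb_lt(3)[OF assms(1) V(1) assms(3)] emb_lt(3)[OF assms(2) V(2) assms(3)] w(2) V by simp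
qed

lemma emb_image_rset:
  assumes "x \<in> embs n" "1 \<le> n div k" "W \<subseteq> V"
  shows "emb n x ` W \<subseteq> {..<n}" "card (emb n x ` W) = card W"
  using assms emb_lt(1)[OF assms(1) _ assms(2)] inj_on_subset[OF inj_emb[OF assms(1,2)] assms(3)]
  by (auto intro!: card_image)

lemma card_ray_minus: "i < l1 \<Longrightarrow> card (ray i - C) = r"
  using ray[of i] cardC rs CV finV by (subst card_Diff_subset) (auto intro: finite_subset)

lemma ray_role_in: "x \<in> embs n \<Longrightarrow> 1 \<le> n div k \<Longrightarrow> i < l1 \<Longrightarrow> ray_role n i x \<in> rsets n r"
  using emb_image_rset[of x n "ray i - C"] ray[of i] card_ray_minus[of i]
  by (auto simp: ray_role_def rsets_def)

lemma cap_role_in: "x \<in> embs n \<Longrightarrow> 1 \<le> n div k \<Longrightarrow> j < l2 \<Longrightarrow> cap_role n j x \<in> rsets n r"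
  using emb_image_rset[of x n "S j"] S[of j] cap[of j]
  by (auto simp: cap_role_def rsets_def)

lemma strat_eq_response:
  assumes "x \<in> embs n" "1 \<le> n div k" "W \<subseteq> V" "U = emb n x ` A" "A \<subseteq> V" "W \<inter> A = {}"
    "card W = s - r" "response n h U = emb n x ` W"
  shows "strat n h U = emb n x ` W"
proof -
  have "emb n x ` W \<inter> emb n x ` A = {}"
    using inj_on_image_Int[OF inj_emb[OF assms(1,2)] assms(3,5)] assms(6) by simp
  then have "emb n x ` W \<subseteq> {..<n} - U" using emb_image_rset(1)[OF assms(1-3)] assms(4) by auto
  then show ?thesis using emb_image_rset(2)[OF assms(1-3)] assms(7,8) by (simp add: strat_def)
qed

text \<open>The positions of the round lie in \<open>[L T, 2 L T)\<close> for
  \<open>L = l1 + l2\<close>, so division by \<open>L\<close> lands in \<open>[T, 2 T)\<close>,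
  where \<open>floor_log\<close> is constant because \<open>T\<close> is a power of two.\<close>

lemma block_position:
  assumes "T = 2 ^ a" "i < l1 + l2" "p < T"
  shows "round_len ((l1 + l2) * T + (i * T + p)) = T" "(i * T + p) div T = i"
proof -
  let ?L = "l1 + l2"
  have L: "?L > 0" using l1 by simp
  have "i * T + p < Suc i * T" using assms by simp
  also have "\<dots> \<le> ?L * T" using assms by (intro mult_right_mono) auto
  finally have ip: "i * T + p < ?L * T" .
  then have "(i * T + p) div ?L < T" using L by (simp add: less_mult_imp_div_less mult.commute)
  then have "(?L * T + (i * T + p)) div ?L < 2 * T" "T \<le> (?L * T + (i * T + p)) div ?L"
    using L by simp_all
  then have "floor_log ((?L * T + (i * T + p)) div ?L) = a"
    using assms(1) by (intro floor_log_eqI) (auto intro: less_le_trans[of 0 T])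
  then show "round_len (?L * T + (i * T + p)) = T" using assms(1) by (simp add: round_len_def)
  show "(i * T + p) div T = i" using assms by simp
qed

lemma finite_embs: "finite (embs n)"
  unfolding embs_def using finV by (intro finite_PiE) auto

text \<open>The length of \<open>pre\<close> places \<open>us\<close> on the ray blocks and
  \<open>vs\<close> on the cap blocks of the round. Apart from that \<open>pre\<close> and
  \<open>post\<close> are arbitrary, since the plan depends only on the position and on random sets
  of the current round.\<close>

lemma round_success:
  assumes T: "T = 2 ^ a" and n: "1 \<le> n div k"
    and len: "length pre = (l1 + l2) * T" "length us = l1 * T" "length vs = l2 * T"
    and x: "x \<in> family n T us" and hit: "hits l2 T (\<lambda>j. cap_role n j x) vs"
    and E: "E = ray ` {..<l1} \<union> cap ` {..<l2}"
  shows "has_copy n V E (graph_edges strat n (pre @ us @ vs @ post))"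
proof -
  let ?L = "l1 + l2" and ?Us = "pre @ us @ vs @ post"
  have fin: "finite {x \<in> embs n. hits l1 T (\<lambda>i. ray_role n i x) us}"
    using finite_embs[of n] by simp
  note fam = max_indep[OF fin, where conf = "conf n", folded family_def]
  have xe: "x \<in> embs n" and xh: "hits l1 T (\<lambda>i. ray_role n i x) us" using fam(1) x by auto
  have T0: "T > 0" using T by simp
  have edge: "Us ! j \<union> strat n (play strat n (take j Us)) (Us ! j) \<in> set (graph_edges strat n Us)"
    if "j < length Us" for j Us
    using that nth_graph_edges[OF that, of strat n] by (metis length_graph_edges nth_mem)
  have blk_pos: "\<exists>p<T. i * T + p < length ws \<and> ws ! (i * T + p) = u" if u: "u \<in> set (blk T i ws)" for i u and ws :: "nat set list"
  proof -
    obtain p where "p < length (blk T i ws)" "blk T i ws ! p = u" using u by (auto simp: in_set_conv_nth)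
    then show ?thesis by (intro exI[of _ p]) (auto simp: blk_def)
  qed
  have rays: "emb n x ` ray i \<in> set (graph_edges strat n ?Us)" if i: "i < l1" for i
  proof -
    obtain p where p: "p < T" "i * T + p < length us" "us ! (i * T + p) = ray_role n i x"
      using xh i blk_pos unfolding hits_def by metis
    define j where "j = ?L * T + (i * T + p)"
    have j: "j < length ?Us" "?Us ! j = ray_role n i x"
      using p len by (auto simp: j_def nth_append)
    let ?h = "play strat n (take j ?Us)"
    have lh: "length ?h = j" using j by simp
    have pos: "round_len j = T" "(i * T + p) div T = i"
      using block_position[OF T, of i p] i p by (auto simp: j_def)
    have "response n ?h (ray_role n i x) = emb n (\<lambda>_. 0) ` C"
      unfolding response_def lh Let_def pos(1) using pos(2) i by (simp add: j_def)
    \<comment> \<open>The image of the center is the same for all copies, so one answer serves every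
      copy that uses this set for its \<open>i\<close>-th ray.\<close>
    also have "\<dots> = emb n x ` C" by (intro image_cong) (auto simp: emb_def)
    finally have "strat n ?h (ray_role n i x) = emb n x ` C"
      using ray[OF i] CV cardC by (intro strat_eq_response[OF xe n, where A = "ray i - C"]) (auto simp: ray_role_def)
    then have "?Us ! j \<union> strat n ?h (?Us ! j) = emb n x ` (ray i - C) \<union> emb n x ` C"
      by (simp only: j(2) ray_role_def)
    also have "\<dots> = emb n x ` ray i" using ray[OF i] by (auto simp flip: image_Un)
    finally show ?thesis using edge[OF j(1)] by simp
  qed
  have caps: "emb n x ` cap b \<in> set (graph_edges strat n ?Us)" if b: "b < l2" for b
  proof -
    obtain p where p: "p < T" "b * T + p < length vs" "vs ! (b * T + p) = cap_role n b x"
      using hit b blk_pos unfolding hits_def by metis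
    define j where "j = ?L * T + ((l1 + b) * T + p)"
    have j: "j < length ?Us" "?Us ! j = cap_role n b x"
      using p len by (auto simp: j_def nth_append add_mult_distrib)
    let ?h = "play strat n (take j ?Us)"
    have lh: "length ?h = j" using j by simp
    have pos: "round_len j = T" "((l1 + b) * T + p) div T = l1 + b"
      using block_position[OF T, of "l1 + b" p] b p by (auto simp: j_def)
    have us: "take (l1 * T) (drop (?L * T) (map fst ?h)) = us"
      using len by (simp add: j_def add_mult_distrib)
    \<comment> \<open>Two members of the family with the same cap role would conflict, so the choice
      operator must return \<open>x\<close> itself.\<close>
    have some: "(SOME x'. x' \<in> family n T us \<and> cap_role n b x' = cap_role n b x) = x"
    proof (rule some_equality)
      fix x' assume x': "x' \<in> family n T us \<and> cap_role n b x' = cap_role n b x"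
      then have "\<not> conf n x' x" using fam(2) x by (auto simp: indep_def)
      then show "x' = x" using x' b by (auto simp: conf_def)
    qed (use x in simp)
    have "response n ?h (cap_role n b x) = emb n x ` (cap b - S b)"
      unfolding response_def lh Let_def pos(1) us using pos(2) some by (simp add: j_def)
    moreover have "card (cap b - S b) = s - r"
      using cap[OF b] S[OF b] finV by (subst card_Diff_subset) (auto intro: finite_subset)
    ultimately have "strat n ?h (cap_role n b x) = emb n x ` (cap b - S b)"
      using cap[OF b] S[OF b]
      by (intro strat_eq_response[OF xe n, where A = "S b"]) (auto simp: cap_role_def)
    then have "?Us ! j \<union> strat n ?h (?Us ! j) = emb n x ` S b \<union> emb n x ` (cap b - S b)"
      by (simp only: j(2) cap_role_def)
    also have "\<dots> = emb n x ` cap b" using S[OF b] by (auto simp flip: image_Un)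
    finally show ?thesis using edge[OF j(1)] by simp
  qed
  show ?thesis
    unfolding has_copy_def using inj_emb[OF xe n] emb_image_rset(1)[OF xe n order_refl] rays caps
    by (intro exI[of _ "emb n x"]) (auto simp: E)
qed

end

subsection \<open>The upper bound\<close>

text \<open>The bound \<open>T / (T + card R)\<close> has the right order for small and for large
  \<open>T\<close> alike, so it serves every \<open>t\<close> above the threshold. It combines
  Bernoulli with \<open>(1 - 1/M)^T * (1 + 1/M)^T <= 1\<close>.\<close>

lemma hitp_ge:
  assumes "finite R" "R \<noteq> {}" "T > 0"
  shows "1 / (1 + real (card R) / real T) \<le> hitp R T"
proof -
  let ?M = "real (card R)"
  have M: "?M \<ge> 1" using assms by (simp add: Suc_le_eq card_gt_0_iff)
  have b: "1 + real T / ?M \<le> (1 + 1 / ?M) ^ T"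
    using Bernoulli_inequality[of "1 / ?M" T] M by (simp add: order_trans[of "-1" 0])
  have "(1 - 1 / ?M) ^ T * (1 + real T / ?M) \<le> (1 - 1 / ?M) ^ T * (1 + 1 / ?M) ^ T"
    using M b by (intro mult_left_mono) auto
  also have "\<dots> = (1 - 1 / ?M * (1 / ?M)) ^ T"
    by (simp add: algebra_simps flip: power_mult_distrib)
  also have "\<dots> \<le> 1"
    using M mult_mono[of "1 / ?M" 1 "1 / ?M" 1] by (intro power_le_one) auto
  finally have "(1 - 1 / ?M) ^ T \<le> 1 / (1 + real T / ?M)"
    using M by (subst pos_le_divide_eq) (auto intro: add_pos_nonneg)
  moreover have "1 - 1 / (1 + real T / ?M) = 1 / (1 + ?M / real T)"
    using M assms(3) by (simp add: field_simps)
  ultimately show ?thesis by (simp add: hitp_def)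
qed

context starplus_play
begin

text \<open>Absence of a copy forces an event that involves \<open>us\<close> and \<open>vs\<close>
  only, so averaging over \<open>pre\<close> and \<open>post\<close> leaves its bound
  unchanged.\<close>

lemma prob_copy_ge:
  fixes \<theta> y :: real
  assumes T: "T = 2 ^ a" and n: "1 \<le> n div k" "r \<le> n" and t: "2 * (l1 + l2) * T \<le> t"
    and E: "E = ray ` {..<l1} \<union> cap ` {..<l2}"
    and m: "m = card (V - C)" "r < m" "m \<le> r * l1"
    and dens: "real (l1 + l2) * (real m - real r) \<le> real m * (real l1 - 1)"
    and \<theta>: "\<theta> = real m / real (l1 + l2)"
    and bal: "\<And>I. I \<subseteq> {..<l1} \<Longrightarrow> I \<noteq> {} \<Longrightarrow>
        (real (card I) - 1) * (real m - real r) \<le> (real l1 - 1) * (real (card (\<Union>i\<in>I. ray i - C)) - real r)"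
    and y: "y = hitp (rsets n r) T * real (n div k) powr \<theta>" "1 \<le> y"
  shows "1 - (4 * 2 ^ l1 * (1 + real l2) + 32) / sqrt y \<le> prob_copy r strat n t V E"
proof -
  let ?R = "rsets n r" and ?K = "(4 * 2 ^ l1 * (1 + real l2) + 32) / sqrt y"
  let ?hc = "\<lambda>Us. has_copy n V E (graph_edges strat n Us)"
  let ?fail = "\<lambda>us vs. \<forall>x\<in>family n T us. \<not> hits l2 T (\<lambda>j. cap_role n j x) vs"
  have R: "finite ?R" "?R \<noteq> {}" using finite_rsets rsets_nonempty n(2) by auto
  have fVC: "finite (V - C)" using finV by simp
  have fail: "avg ?R (l1 * T) (\<lambda>us. avg ?R (l2 * T) (\<lambda>vs. of_bool (?fail us vs))) \<le> ?K"
    unfolding family_def embs_def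
  proof (rule block_failure[OF fVC m(1)[symmetric] R n(1), where Q = "\<lambda>i. ray i - C" and S = S and \<theta> = \<theta>])
    show "\<And>x y. conf n x y \<longleftrightarrow> x \<noteq> y \<and> (\<exists>j<l2. cap_role n j x = cap_role n j y)"
      by (simp add: conf_def)
    show "\<forall>v\<in>ray i - C. x v = z v" if "x \<in> V - C \<rightarrow>\<^sub>E {..<n div k}" "z \<in> V - C \<rightarrow>\<^sub>E {..<n div k}" "i < l1"
      "ray_role n i x = ray_role n i z" for x z i
      using that n(1) ray[of i] by (intro emb_image_eq) (auto simp: embs_def ray_role_def)
    show "\<forall>v\<in>S i. x v = z v" if "x \<in> V - C \<rightarrow>\<^sub>E {..<n div k}" "z \<in> V - C \<rightarrow>\<^sub>E {..<n div k}" "i < l2"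
      "cap_role n i x = cap_role n i z" for x z i
      using that n(1) S[of i] cap[of i] by (intro emb_image_eq) (auto simp: embs_def cap_role_def)
    show "ray_role n i x \<in> ?R" if "x \<in> V - C \<rightarrow>\<^sub>E {..<n div k}" "i < l1" for x i
      using that n(1) by (intro ray_role_in) (auto simp: embs_def)
    show "cap_role n i x \<in> ?R" if "x \<in> V - C \<rightarrow>\<^sub>E {..<n div k}" "i < l2" for x i
      using that n(1) by (intro cap_role_in) (auto simp: embs_def)
    show "ray i - C \<subseteq> V - C" if "i < l1" for i using ray[OF that] by auto
    show "S i \<subseteq> V - C \<and> card (S i) = r" if "i < l2" for i using S[OF that] cap[OF that] by auto
  qed (use m l1 dens \<theta> bal y in auto)
  define rest where "rest = t - 2 * (l1 + l2) * T"
  have tt: "t = (l1 + l2) * T + (l1 * T + (l2 * T + rest))"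
  proof -
    have "2 * (l1 + l2) * T = (l1 + l2) * T + (l1 * T + l2 * T)" by (simp add: algebra_simps)
    then show ?thesis using t unfolding rest_def by linarith
  qed
  have "1 - prob_copy r strat n t V E = avg ?R t (\<lambda>Us. 1 - of_bool (?hc Us))"
    unfolding prob_copy_avg avg_diff[OF R] by (simp add: avg_const R)
  also have "\<dots> = avg ?R ((l1 + l2) * T) (\<lambda>pre. avg ?R (l1 * T) (\<lambda>us. avg ?R (l2 * T) (\<lambda>vs. avg ?R rest
       (\<lambda>post. 1 - of_bool (?hc (pre @ us @ vs @ post))))))"
    unfolding tt avg_add by simp
  also have "\<dots> \<le> avg ?R ((l1 + l2) * T) (\<lambda>pre. avg ?R (l1 * T) (\<lambda>us. avg ?R (l2 * T) (\<lambda>vs. avg ?R rest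
       (\<lambda>post. of_bool (?fail us vs)))))"
  proof (intro avg_mono)
    fix pre us vs post :: "nat set list"
    assume "length pre = (l1 + l2) * T" "length us = l1 * T" "length vs = l2 * T"
    then have "?hc (pre @ us @ vs @ post)" if "\<not> ?fail us vs"
      using that round_success[OF T n(1) _ _ _ _ _ E] by blast
    then show "1 - of_bool (?hc (pre @ us @ vs @ post)) \<le> (of_bool (?fail us vs) :: real)"
      by (cases "?fail us vs") auto
  qed
  also have "\<dots> \<le> avg ?R ((l1 + l2) * T) (\<lambda>pre. ?K)"
    using fail by (intro avg_mono) (simp add: avg_const R)
  also have "\<dots> = ?K" by (simp add: avg_const R)
  finally show ?thesis by simp
qed

lemma upper_bound:
  fixes \<theta> :: real
  assumes E: "E = ray ` {..<l1} \<union> cap ` {..<l2}" and k: "0 < k"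
    and m: "m = card (V - C)" "r < m" "m \<le> r * l1"
    and dens: "real (l1 + l2) * (real m - real r) \<le> real m * (real l1 - 1)"
    and \<theta>: "\<theta> = real m / real (l1 + l2)"
    and bal: "\<And>I. I \<subseteq> {..<l1} \<Longrightarrow> I \<noteq> {} \<Longrightarrow>
        (real (card I) - 1) * (real m - real r) \<le> (real l1 - 1) * (real (card (\<Union>i\<in>I. ray i - C)) - real r)"
  shows "tau_upper r s V E (\<lambda>n. real n powr (real r - \<theta>))"
  unfolding tau_upper_def
proof (intro exI[of _ strat] conjI valid_strat allI impI)
  fix t :: "nat \<Rightarrow> nat"
  let ?f = "\<lambda>n. real n powr (real r - \<theta>)"
  assume t: "?f \<in> o(\<lambda>n. real (t n))"
  define L where "L = l1 + l2"
  have L: "L > 0" using l1 by (simp add: L_def)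
  have \<theta>0: "\<theta> > 0" using m(2) L unfolding \<theta> L_def by (intro divide_pos_pos) auto
  \<comment> \<open>Because the rays cover, the threshold is at least 1; hence eventually
    \<open>t >= 2 L\<close> and a whole round fits.\<close>
  have \<theta>r: "\<theta> \<le> real r"
  proof -
    have "real m \<le> real r * real l1" using m(3) by (metis of_nat_le_iff of_nat_mult)
    also have "\<dots> \<le> real r * real (l1 + l2)" by (intro mult_left_mono) auto
    finally show ?thesis unfolding \<theta> using l1 by (intro mult_imp_div_pos_le) auto
  qed
  define K where "K = 4 * 2 ^ l1 * (1 + real l2) + 32"
  have K0: "K > 0" unfolding K_def by (intro add_nonneg_pos) auto
  \<comment> \<open>An explicit upper bound for \<open>1 / y\<close>. With at most
    \<open>n^r\<close> many \<open>r\<close>-sets and \<open>T >= t / (4 L)\<close>,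
    \<open>1 / q\<close> is at most \<open>1 + 4 L n^r / t\<close>; multiplying by
    \<open>(2 k / n) powr \<theta>\<close>, which bounds \<open>(n div k) powr - \<theta>\<close>,
    gives two parts that vanish, the second being a multiple of the threshold over
    \<open>t\<close>.\<close>
  define w where "w n = (2 * real k) powr \<theta> * (real n powr - \<theta> + 4 * real L * (?f n / real (t n)))" for n
  have w0: "w \<longlonglongrightarrow> 0"
  proof -
    have "(\<lambda>n. real n powr - \<theta>) \<longlonglongrightarrow> 0"
      using tendsto_neg_powr[of "- \<theta>" real sequentially] \<theta>0 filterlim_real_sequentially by simp
    then have "(\<lambda>n. (2 * real k) powr \<theta> * (real n powr - \<theta> + 4 * real L * (?f n / real (t n)))) \<longlonglongrightarrow>
        (2 * real k) powr \<theta> * (0 + 4 * real L * 0)"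
      by (intro tendsto_intros smalloD_tendsto[OF t])
    then show ?thesis by (simp add: w_def[abs_def])
  qed
  have "eventually (\<lambda>n. w n < 1) sequentially" using w0 by (rule order_tendstoD) simp
  moreover have "eventually (\<lambda>n. norm (?f n) \<le> 1 / (2 * real L) * norm (real (t n))) sequentially"
    using t L by (intro landau_o.smallD) auto
  moreover have "eventually (\<lambda>n. max (max 1 r) (2 * k) \<le> n) sequentially" by (rule eventually_ge_at_top)
  ultimately have ev: "eventually (\<lambda>n. 1 - K * sqrt (w n) \<le> prob_copy r strat n (t n) V E) sequentially"
  proof eventually_elim
    case (elim n)
    have n: "1 \<le> n" "r \<le> n" "2 * k \<le> n" using elim(3) by auto
    have "1 \<le> ?f n" using n \<theta>r by (intro ge_one_powr_ge_zero) auto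
    also have "?f n \<le> real (t n) / (2 * real L)" using elim(2) by simp
    finally have "real (2 * L) \<le> real (t n)" using L by (simp add: field_simps)
    then have tL: "2 * L \<le> t n" by (simp only: of_nat_le_iff)
    then have tpos: "t n > 0" using L by simp
    define d where "d = t n div (2 * L)"
    have d: "d > 0" using tL L by (simp add: d_def div_greater_zero_iff)
    \<comment> \<open>The largest power of two with \<open>2 L T <= t\<close>: its round ends by
      time \<open>t\<close>, and \<open>T\<close> is still at least
      \<open>t / (4 L)\<close>.\<close>
    define T :: nat where "T = 2 ^ floor_log d"
    have T: "T \<le> d" "d < 2 * T" "T > 0"
      using floor_log_exp2_le[OF d] floor_log_exp2_gt[of d] by (auto simp: T_def)
    have "2 * L * T \<le> 2 * L * d" using T(1) by simp
    also have "\<dots> \<le> t n" by (simp add: d_def)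
    finally have T1: "2 * (l1 + l2) * T \<le> t n" by (simp add: L_def)
    have "t n < Suc d * (2 * L)" unfolding d_def using L by (simp add: dividend_less_div_times add.commute)
    also have "\<dots> \<le> (2 * T) * (2 * L)" using T(2) by (intro mult_right_mono) auto
    finally have T2: "real (t n) \<le> 4 * real L * real T"
      by (metis (mono_tags, lifting) less_imp_le of_nat_le_iff of_nat_mult of_nat_numeral mult.assoc mult.commute mult.left_commute numeral_Bit0 mult_2 distrib_right)
    define n0 where "n0 = n div k"
    have n0: "1 \<le> n0" using n(3) k by (simp add: n0_def Suc_le_eq div_greater_zero_iff)
    have "n < Suc n0 * k" unfolding n0_def using k by (simp add: dividend_less_div_times add.commute)
    also have "\<dots> \<le> (2 * n0) * k" using n0 by (intro mult_right_mono) auto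
    finally have "real n \<le> real ((2 * n0) * k)" by (simp only: of_nat_le_iff less_imp_le)
    then have nk: "real n / (2 * real k) \<le> real n0" using k by (simp add: field_simps)
    let ?R = "rsets n r"
    have R: "finite ?R" "?R \<noteq> {}" using finite_rsets rsets_nonempty n(2) by auto
    define y where "y = hitp ?R T * real n0 powr \<theta>"
    have M: "real (card ?R) \<le> real n powr real r"
    proof -
      have "n choose r \<le> n ^ r" using n(2) by (rule binomial_le_pow)
      then show ?thesis using n(1) by (simp add: card_rsets powr_realpow flip: of_nat_power)
    qed
    have q: "1 / (1 + real (card ?R) / real T) \<le> hitp ?R T" by (rule hitp_ge[OF R T(3)])
    have qpos: "0 < 1 / (1 + real (card ?R) / real T)" by (simp add: add_pos_nonneg)
    have hq: "hitp ?R T > 0" using q qpos by linarith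
    have ypos: "y > 0" unfolding y_def using hq n0 by simp
    have yw: "1 / y \<le> w n"
    proof -
      have "1 / hitp ?R T \<le> 1 + real (card ?R) / real T"
        using le_imp_inverse_le[OF q qpos] by (simp add: inverse_eq_divide)
      also have "\<dots> \<le> 1 + real n powr real r * (4 * real L / real (t n))"
      proof -
        have "1 / real T \<le> 4 * real L / real (t n)"
          using T2 T(3) tpos by (simp add: field_simps)
        then have "real (card ?R) * (1 / real T) \<le> real n powr real r * (4 * real L / real (t n))"
          using M by (intro mult_mono) auto
        then show ?thesis by simp
      qed
      finally have 1: "1 / hitp ?R T \<le> 1 + real n powr real r * (4 * real L / real (t n))" .
      have 2: "1 / real n0 powr \<theta> \<le> (2 * real k) powr \<theta> * real n powr - \<theta>"
      proof -
        have "(real n / (2 * real k)) powr \<theta> \<le> real n0 powr \<theta>"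
          using nk \<theta>0 by (intro powr_mono2) auto
        then have "1 / real n0 powr \<theta> \<le> 1 / (real n / (2 * real k)) powr \<theta>"
          using n k n0 by (intro divide_left_mono) auto
        also have "\<dots> = (2 * real k) powr \<theta> * real n powr - \<theta>"
          using n k by (simp add: powr_divide powr_minus field_simps)
        finally show ?thesis .
      qed
      have "1 / y = 1 / hitp ?R T * (1 / real n0 powr \<theta>)" by (simp add: y_def)
      also have "\<dots> \<le> (1 + real n powr real r * (4 * real L / real (t n))) * ((2 * real k) powr \<theta> * real n powr - \<theta>)"
        using 1 2 hq by (intro mult_mono) (auto intro!: add_nonneg_nonneg)
      also have "\<dots> = w n"
        by (simp add: w_def powr_diff powr_minus divide_inverse algebra_simps)
      finally show ?thesis .
    qed
    have y1: "1 \<le> y"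
    proof -
      have "1 / y < 1" using yw elim(1) by linarith
      then show ?thesis using ypos by (simp add: field_simps)
    qed
    have "1 / sqrt y = sqrt (1 / y)" by (simp add: real_sqrt_divide)
    also have "\<dots> \<le> sqrt (w n)" using yw by (rule real_sqrt_le_mono)
    finally have "K * (1 / sqrt y) \<le> K * sqrt (w n)" using K0 by (intro mult_left_mono) auto
    moreover have "1 - (4 * 2 ^ l1 * (1 + real l2) + 32) / sqrt y \<le> prob_copy r strat n (t n) V E"
      by (rule prob_copy_ge[OF T_def _ n(2) T1 E m dens \<theta> bal y_def[unfolded n0_def] y1])
         (use n0 in \<open>simp_all add: n0_def\<close>)
    ultimately show ?case by (simp add: K_def)
  qed
  have lim: "(\<lambda>n. 1 - K * sqrt (w n)) \<longlonglongrightarrow> 1"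
  proof -
    have "(\<lambda>n. 1 - K * sqrt (w n)) \<longlonglongrightarrow> 1 - K * sqrt 0" by (intro tendsto_intros w0)
    then show ?thesis by simp
  qed
  have "eventually (\<lambda>n. prob_copy r strat n (t n) V E \<le> 1) sequentially"
    using eventually_ge_at_top[of r] by eventually_elim (rule prob_copy_le_1)
  then show "(\<lambda>n. prob_copy r strat n (t n) V E) \<longlonglongrightarrow> 1"
    by (rule tendsto_sandwich[OF ev _ lim tendsto_const])
qed

end

section \<open>From the starplus to the numerical hypotheses\<close>

theorem theorem4:
  fixes V :: "'a set" and E :: "'a set set" and C :: "'a set"
    and r s k l1 l2 :: nat
  assumes "2 \<le> r" and "r < s"
    and "starplus s (s - r) V E C l1 l2"
    and "card V = k" and "k > s"
    and "l1 \<ge> 2"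
    and "real (l1 + l2) / real (l1 - 1) \<le> real (k - s + r) / real (k - s)"
    and "edge_balanced r (V - C) (flower C E)"
  shows "tau_upper r s V E (\<lambda>n. real n powr (real r - real (k - s + r) / real (l1 + l2)))
       \<and> tau_lower r s V E (\<lambda>n. real n powr (real r - real (k - s + r) / real (l1 + l2)))"
proof -
  define Rays Caps where "Rays = {e \<in> E. C \<subseteq> e}" and "Caps = {e \<in> E. \<not> C \<subseteq> e}"
  have sp: "finite V" "\<And>e. e \<in> E \<Longrightarrow> e \<subseteq> V \<and> card e = s" "C \<subseteq> V" "card C = s - r"
    "card Rays = l1" "\<Union> Rays = V" "card Caps = l2"
    using assms(3) by (auto simp: starplus_def Rays_def Caps_def)
  have fE: "finite E" by (rule finite_subset[of _ "Pow V"]) (use sp(1,2) in auto)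
  then have fin: "finite Rays" "finite Caps" by (auto simp: Rays_def Caps_def)
  have EE: "E = Rays \<union> Caps" "Rays \<inter> Caps = {}" by (auto simp: Rays_def Caps_def)
  have cE: "card E = l1 + l2" using card_Un_disjoint[OF fin EE(2)] EE(1) sp(5,7) by simp
  have fC: "finite C" using sp(1,3) finite_subset by blast
  obtain ray where bray: "bij_betw ray {..<l1} Rays"
    using ex_bij_betw_nat_finite[OF fin(1)] sp(5) by (auto simp: atLeast0LessThan)
  obtain cap where bcap: "bij_betw cap {..<l2} Caps"
    using ex_bij_betw_nat_finite[OF fin(2)] sp(7) by (auto simp: atLeast0LessThan)
  obtain idx where bidx: "bij_betw idx V {..<k}"
    using ex_bij_betw_finite_nat[OF sp(1)] assms(4) by (auto simp: atLeast0LessThan)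
  have rayD: "C \<subseteq> ray i \<and> ray i \<subseteq> V \<and> card (ray i) = s" if "i < l1" for i
    using bij_betwE[OF bray] sp(2) that by (auto simp: Rays_def)
  have capD: "cap j \<in> E \<and> \<not> C \<subseteq> cap j" if "j < l2" for j
    using bij_betwE[OF bcap] that by (auto simp: Caps_def)
  \<comment> \<open>A cap edge misses a vertex of the center, so fewer than \<open>s - r\<close> of
    its \<open>s\<close> vertices lie in \<open>C\<close> and at least \<open>r\<close> are left for
    the random set.\<close>
  have "\<exists>W. W \<subseteq> cap j - C \<and> card W = r" if "j < l2" for j
  proof -
    have e: "cap j \<subseteq> V" "card (cap j) = s" "\<not> C \<subseteq> cap j" using capD[OF that] sp(2) by auto
    have fe: "finite (cap j)" using e(1) sp(1) finite_subset by blast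
    have "cap j \<inter> C \<subset> C" using e(3) by auto
    then have "card (cap j \<inter> C) < s - r" using psubset_card_mono[OF fC] sp(4) by metis
    moreover have "card (cap j - C) = s - card (cap j \<inter> C)" using fe e(2) by (simp add: card_Diff_subset_Int)
    ultimately have "r \<le> card (cap j - C)" using assms(2) by linarith
    then show ?thesis using obtain_subset_with_card_n by metis
  qed
  then obtain S where S: "\<And>j. j < l2 \<Longrightarrow> S j \<subseteq> cap j - C \<and> card (S j) = r" by metis
  interpret starplus_play V C r s k l1 l2 idx ray cap S
  proof
    show "inj_on idx V" "\<And>v. v \<in> V \<Longrightarrow> idx v < k" using bidx by (auto simp: bij_betw_def)
    show "\<And>j. j < l2 \<Longrightarrow> cap j \<subseteq> V \<and> card (cap j) = s" using capD sp(2) by blast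
  qed (use sp rayD S assms in auto)
  define m where "m = card (V - C)"
  have m: "m = k - s + r" using sp(3,4) fC assms by (simp add: m_def card_Diff_subset)
  have mr: "r < m" using m assms by simp
  \<comment> \<open>All rays contain \<open>C\<close>, so removing it keeps them distinct and the
    flower has exactly \<open>l1\<close> edges.\<close>
  have injQ: "inj_on (\<lambda>i. ray i - C) {..<l1}"
  proof (rule inj_onI)
    fix i j assume a: "i \<in> {..<l1}" "j \<in> {..<l1}" "ray i - C = ray j - C"
    then have "ray i = ray j" using rayD[of i] rayD[of j] by auto
    then show "i = j" by (rule inj_onD[OF bij_betw_imp_inj_on[OF bray]]) (use a in auto)
  qed
  have fl: "flower C E = (\<lambda>i. ray i - C) ` {..<l1}"
  proof -
    have "flower C E = (\<lambda>e. e - C) ` Rays" by (auto simp: flower_def Rays_def)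
    also have "Rays = ray ` {..<l1}" using bray by (simp add: bij_betw_def)
    finally show ?thesis by (simp add: image_image)
  qed
  have cfl: "card (flower C E) = l1" unfolding fl using card_image[OF injQ] by simp
  have "V - C = (\<Union>i<l1. ray i - C)"
    using sp(6) bray by (auto simp: bij_betw_def)
  then have "m \<le> (\<Sum>i<l1. card (ray i - C))"
    unfolding m_def using card_UN_le[of "{..<l1}" "\<lambda>i. ray i - C"] by (simp only: finite_lessThan)
  also have "\<dots> = r * l1" using card_ray_minus by simp
  finally have cover: "m \<le> r * l1" .
  have dens: "real (l1 + l2) * (real m - real r) \<le> real m * (real l1 - 1)"
  proof -
    have e: "real (k - s) = real m - real r" "real (l1 - 1) = real l1 - 1"
      using m assms by auto
    have "real (l1 + l2) / (real l1 - 1) \<le> real m / (real m - real r)"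
      using assms(7) unfolding m[symmetric] e .
    then show ?thesis using assms(6) mr by (simp add: field_simps)
  qed
  have bal: "(real (card I) - 1) * (real m - real r) \<le> (real l1 - 1) * (real (card (\<Union>i\<in>I. ray i - C)) - real r)"
    if I: "I \<subseteq> {..<l1}" "I \<noteq> {}" for I
  proof -
    let ?V = "\<Union>i\<in>I. ray i - C" and ?E = "(\<lambda>i. ray i - C) ` I"
    have fI: "finite I" using finite_subset[OF I(1)] by simp
    have cI: "card ?E = card I" by (rule card_image[OF inj_on_subset[OF injQ I(1)]])
    have VV: "?V \<subseteq> V - C"
    proof (rule UN_least)
      fix i assume "i \<in> I"
      then have "i < l1" using I(1) by auto
      then show "ray i - C \<subseteq> V - C" using rayD[of i] by auto
    qed
    have fV: "finite ?V" by (rule finite_subset[OF VV]) (use sp(1) in simp)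
    obtain i where i: "i \<in> I" using I(2) by blast
    have ci: "card (ray i - C) = r" using i I(1) by (intro card_ray_minus) auto
    have iV: "ray i - C \<subseteq> ?V" by (rule UN_upper[OF i])
    have vr: "r \<le> card ?V" using card_mono[OF fV iV] ci by simp
    show ?thesis
    \<comment> \<open>For one edge \<open>gdens\<close> has its special value, but there the left
      side is 0. Otherwise two distinct \<open>r\<close>-sets span more than \<open>r\<close>
      vertices, so both denominators are positive and can be cleared.\<close>
    proof (cases "card I = 1")
      case True
      then show ?thesis using vr assms(6) by simp
    next
      case False
      have "card I > 0" using fI I(2) by (simp add: card_gt_0_iff)
      then have "I \<noteq> {i}" using False by auto
      then obtain j where j: "j \<in> I" "j \<noteq> i" using i by blast
      have "ray j - C \<noteq> ray i - C" using injQ i j I(1) by (auto dest: inj_onD)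
      moreover have "card (ray j - C) = r" using j I(1) by (intro card_ray_minus) auto
      ultimately have "\<not> ray j - C \<subseteq> ray i - C"
        using card_subset_eq[OF finite_subset[OF iV fV], of "ray j - C"] ci by auto
      moreover have "ray j - C \<subseteq> ?V" by (rule UN_upper[OF j(1)])
      ultimately have "ray i - C \<subset> ?V" using iV by blast
      then have vr': "r < card ?V" using psubset_card_mono[OF fV] ci by metis
      have "gdens r (card ?V) (card ?E) \<le> gdens r (card (V - C)) (card (flower C E))"
      proof (rule assms(8)[unfolded edge_balanced_def, rule_format], intro conjI)
        show "?E \<subseteq> flower C E" unfolding fl by (rule image_mono[OF I(1)])
        show "\<forall>e\<in>?E. e \<subseteq> ?V" by blast
        show "?E \<noteq> {}" using I(2) by simp
      qed (rule VV)
      then have "(real (card I) - 1) / (real (card ?V) - real r) \<le> (real l1 - 1) / (real m - real r)"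
        using False assms(6) by (simp add: gdens_def cI cfl m_def)
      then show ?thesis using vr' mr by (simp add: field_simps)
    qed
  qed
  have "E = ray ` {..<l1} \<union> cap ` {..<l2}" using EE(1) bray bcap by (simp add: bij_betw_def)
  from upper_bound[OF this _ m_def mr cover dens refl bal] assms(5)
  have "tau_upper r s V E (\<lambda>n. real n powr (real r - real m / real (l1 + l2)))" by simp
  moreover have "tau_lower r s V E (\<lambda>n. real n powr (real r - real (card V - s + r) / real (card E)))"
  proof (rule general_lower_bound[OF _ sp(1,2)])
    show "E \<noteq> {}" using cE assms(6) by auto
  qed (use assms(1,4,5) in auto)
  ultimately show ?thesis unfolding assms(4) cE m by (rule conjI)
qed

end
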